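(* Let $p\ge1$ and $n\ge2$ be integers, let $X$ be an $n\times p$ real matrix, let $L>0$, and let $$K:=\{X\gamma:\ \gamma\in\mathbb{R}^p,\ |\gamma|_1\le L\}.$$ Let $\Sigma:=X^TX/n$, and let $a$ and $b$ be the smallest and largest eigenvalues of $\Sigma$. Assume that $a>0$ and that all diagonal entries of $\Sigma$ are equal to $1$. Take any $\beta\in\mathbb{R}^p$ and let $\mu:=X\beta$. Let $s$ be the number of nonzero entries of $\beta$, let $\delta:=L-|\beta|_1$, and let $r:=p/n$. Let $t_\mu$ be defined from $K$ and $\mu$ as in the context. (i) If $\delta>0$, then given any $\varepsilon>0$ there is a constant $C_1$ depending only on $\delta,\varepsilon,a,b,s,r$ and $L$ such that whenever $n>C_1$, we have $$n^{1/4-\varepsilon}\le t_\mu\le n^{1/4+\varepsilon}.$$ (ii) If $\delta=0$, then there is a constant $C_2$ depending only on $a,b,s,r$ and $L$ such that $$t_\mu\le C_2\sqrt{\log n}.$$ (iii) If $\delta<0$, there are positive constants $C_3$ and $C_4$ depending only on $\delta,a,b,s,r$ and $L$ such that $$C_3\sqrt n\le t_\mu\le C_4\sqrt n.$$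
   Context: $|\gamma|_1$ is the $\ell^1$ norm of $\gamma$; $\|\cdot\|$ is the Euclidean norm and $x\cdot y$ the usual inner product on $\mathbb{R}^n$; $Z$ is an $n$-dimensional standard Gaussian random vector. For a nonempty closed convex $K\subseteq\mathbb{R}^n$, $\mu\in\mathbb{R}^n$ and $t\ge0$, $f_\mu(t):=\mathbb{E}\bigl(\sup_{\nu\in K:\|\nu-\mu\|\le t}Z\cdot(\nu-\mu)\bigr)-t^2/2$, with the convention that the supremum of an empty set is $-\infty$ (so $f_\mu(t)=-\infty$ if no $\nu\in K$ is within distance $t$ of $\mu$). $t_\mu$ is the unique point of $[0,\infty)$ at which $f_\mu$ attains its maximum (it exists and is unique). *)

theory Defs
  imports "HOL-Probability.Probability" "Jordan_Normal_Form.Char_Poly"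
begin

unbundle no inner_syntax
unbundle no vec_syntax

text \<open>Vectors and matrices are those of \<^theory>\<open>Jordan_Normal_Form.Matrix\<close>, with dimensions as
  natural numbers, so that constants can be chosen before the dimensions \<^term>\<open>n\<close> and \<^term>\<open>p\<close>.\<close>

definition l1_norm :: "real Matrix.vec \<Rightarrow> real" where
  "l1_norm v = (\<Sum>i<dim_vec v. \<bar>v $ i\<bar>)"

definition l2_norm :: "real Matrix.vec \<Rightarrow> real" where
  "l2_norm v = sqrt (\<Sum>i<dim_vec v. (v $ i)\<^sup>2)"

text \<open>The law of the coordinates of an \<open>n\<close>-dimensional standard Gaussian vector. A point
  \<open>z\<close> of this space is turned into the vector \<open>Matrix.vec n z\<close>.\<close>

definition std_gaussian :: "nat \<Rightarrow> (nat \<Rightarrow> real) measure" where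
  "std_gaussian n = (\<Pi>\<^sub>M i\<in>{..<n}. density lborel (\<lambda>x. ennreal (std_normal_density x)))"

text \<open>The function \<open>f\<^sub>\<mu>\<close> for \<open>K\<close> contained in \<^term>\<open>carrier_vec n\<close>. When the localized set is nonempty,
  the supremum is finite (its absolute value is at most \<open>t\<close> times the norm of the Gaussian vector),
  so the real-valued supremum and integral are the intended ones.\<close>

definition localized_width ::
    "nat \<Rightarrow> real Matrix.vec set \<Rightarrow> real Matrix.vec \<Rightarrow> real \<Rightarrow> ereal" where
  "localized_width n K \<mu> t =
     (if {\<nu> \<in> K. l2_norm (\<nu> - \<mu>) \<le> t} = {} then - \<infinity>
      else ereal ((\<integral>z. (SUP \<nu> \<in> {\<nu> \<in> K. l2_norm (\<nu> - \<mu>) \<le> t}. Matrix.vec n z \<bullet> (\<nu> - \<mu>))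
                     \<partial>std_gaussian n) - t\<^sup>2 / 2))"

definition t_opt :: "nat \<Rightarrow> real Matrix.vec set \<Rightarrow> real Matrix.vec \<Rightarrow> real" where
  "t_opt n K \<mu> =
     (THE t. 0 \<le> t \<and> (\<forall>t'\<ge>0. localized_width n K \<mu> t' \<le> localized_width n K \<mu> t))"

definition l1_image :: "real Matrix.mat \<Rightarrow> real \<Rightarrow> real Matrix.vec set" where
  "l1_image X L = {X *\<^sub>v \<gamma> | \<gamma>. \<gamma> \<in> carrier_vec (dim_col X) \<and> l1_norm \<gamma> \<le> L}"

definition gram :: "real Matrix.mat \<Rightarrow> real Matrix.mat" where
  "gram X = (1 / real (dim_row X)) \<cdot>\<^sub>m (X\<^sup>T * X)"

definition smallest_eigenvalue :: "real Matrix.mat \<Rightarrow> real \<Rightarrow> bool" where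
  "smallest_eigenvalue A a \<longleftrightarrow> eigenvalue A a \<and> (\<forall>k. eigenvalue A k \<longrightarrow> a \<le> k)"

definition largest_eigenvalue :: "real Matrix.mat \<Rightarrow> real \<Rightarrow> bool" where
  "largest_eigenvalue A b \<longleftrightarrow> eigenvalue A b \<and> (\<forall>k. eigenvalue A k \<longrightarrow> k \<le> b)"

text \<open>The standing assumptions together with the equations defining the parameters
  \<open>a, b, s, \<delta>, r\<close> in terms of \<open>X, L, \<beta>\<close>.\<close>

definition lasso_setup ::
    "nat \<Rightarrow> nat \<Rightarrow> real Matrix.mat \<Rightarrow> real Matrix.vec \<Rightarrow>
     real \<Rightarrow> real \<Rightarrow> real \<Rightarrow> nat \<Rightarrow> real \<Rightarrow> real \<Rightarrow> bool" where
  "lasso_setup n p X \<beta> L a b s \<delta> r \<longleftrightarrow>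
     1 \<le> p \<and> 2 \<le> n \<and> X \<in> carrier_mat n p \<and> \<beta> \<in> carrier_vec p \<and> 0 < L \<and>
     smallest_eigenvalue (gram X) a \<and> largest_eigenvalue (gram X) b \<and> 0 < a \<and>
     (\<forall>i<p. gram X $$ (i, i) = 1) \<and>
     s = card {i. i < p \<and> \<beta> $ i \<noteq> 0} \<and>
     \<delta> = L - l1_norm \<beta> \<and>
     r = real p / real n"

end

theory Submission
  imports Defs "HOL-Real_Asymp.Real_Asymp"
begin

text \<open>
  Write \<open>\<nu> - \<mu> = X h\<close> with \<open>h = \<gamma> - \<beta>\<close>, let \<open>g j\<close> be the inner product of \<open>Z\<close> with the \<open>j\<close>-th
  column of \<open>X\<close> divided by \<open>sqrt n\<close>, and let \<open>m t\<close> be the expected supremum in \<open>f\<^sub>\<mu> t\<close>, so that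
  \<open>f\<^sub>\<mu> t = m t - t\<^sup>2 / 2\<close>. The diagonal assumption on \<open>\<Sigma>\<close> makes every \<open>g j\<close> a standard normal
  variable, and \<open>Z \<bullet> X h = sqrt n * (\<Sum>j. h j * g j)\<close>. The eigenvalue bounds say that
  the norm of \<open>X h\<close> lies between \<open>sqrt (a n)\<close> and \<open>sqrt (b n)\<close> times the norm of \<open>h\<close>.

  The function \<open>m\<close> is concave and continuous from the distance \<open>t0\<close> of \<open>\<mu>\<close> to \<open>K\<close> onwards, and
  constant once the ball contains \<open>K\<close>. Hence \<open>f\<^sub>\<mu>\<close> is strictly concave there and has exactly
  one maximiser (\<open>ex1_profile_max\<close>); all bounds on \<open>t\<^sub>\<mu>\<close> compare values of \<open>f\<^sub>\<mu>\<close> with its value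
  at the maximiser.

  \<^item> If \<open>\<delta> < 0\<close>, every feasible \<open>h\<close> has \<open>l1\<close> norm at least \<open>-\<delta>\<close> on the \<open>s\<close> coordinates of the support
    of \<open>\<beta>\<close>. This gives a lower bound of order \<open>sqrt n\<close> for \<open>t0\<close>, while the diameter of \<open>K\<close>
    has at most the same order.

  \<^item> If \<open>\<delta> = 0\<close>, feasible \<open>h\<close> lie in the cone where the \<open>l1\<close> norm is at most twice the \<open>l1\<close> norm on
    the support. Inside the ball of radius \<open>t\<close> the \<open>l1\<close> norm is therefore at most a multiple of
    \<open>t / sqrt n\<close>, and the maximum of the \<open>\<bar>g j\<bar>\<close> is of order \<open>sqrt (ln n)\<close>. So \<open>m t\<close> is at most a
    multiple of \<open>t * sqrt (ln n)\<close>, and \<open>m t - t\<^sup>2 / 2 \<ge> 0\<close> at the maximiser bounds it.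

  \<^item> If \<open>\<delta> > 0\<close>, the same maximal inequality bounds \<open>m\<close> by a multiple of \<open>sqrt (n * ln n)\<close>, which
    gives the upper bound. For the lower bound the leading constant of \<open>m\<close> matters. In the
    ball of radius \<open>n powr (1/4 - \<epsilon>)\<close> the mass of \<open>h\<close> has to be spread over about
    \<open>n powr (1/2 + 2 * \<epsilon>)\<close> coordinates, on which \<open>\<bar>g j\<bar>\<close> is typically below
    \<open>u1 = sqrt ((1 - 4 * \<epsilon>) * ln n)\<close>; so \<open>m\<close> is at most \<open>sqrt n * (\<delta> * u1 + C)\<close> there
    (\<open>width_le_threshold\<close>, which is Cauchy--Schwarz for the part of \<open>\<bar>g j\<bar>\<close> above the threshold).
    At the larger radius \<open>n powr (1/4 - \<epsilon> / 2)\<close> the vector \<open>h\<close> can be put uniformly on the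
    coordinates where \<open>g j\<close> exceeds \<open>u2 = sqrt ((1 - 3 * \<epsilon>) * ln n)\<close>, so \<open>m\<close> is at least about
    \<open>sqrt n * \<delta> * u2\<close> (\<open>width_ge_threshold\<close>). The gap \<open>sqrt n * \<delta> * (u2 - u1)\<close> exceeds both
    \<open>sqrt n * C\<close> and half the squared radius, so the maximiser cannot lie below the smaller radius.

  The lower bound at \<open>u2\<close> requires the number of exceedances to concentrate although the \<open>g j\<close>
  are correlated. A second moment argument suffices: since the squares in each row of
  the correlation matrix sum to at most \<open>b\<close>, few pairs have a correlation above \<open>n powr (-1/8)\<close>, and for
  the remaining pairs the joint exceedance probability is almost the product
  (\<open>prob_gaussian_pair_ge\<close>).
\<close>

section \<open>Linear functionals of a Gaussian vector\<close>

lemma std_normal_exp: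
  shows integrable_std_normal_exp: "integrable std_normal_distribution (\<lambda>x. exp (c * x))"
    and integral_std_normal_exp: "(\<integral>x. exp (c * x) \<partial>std_normal_distribution) = exp (c\<^sup>2 / 2)"
proof -
  have eq: "std_normal_density x *\<^sub>R exp (c * x) = exp (c\<^sup>2 / 2) * normal_density c 1 x" for x
    unfolding normal_density_def
    by (simp add: exp_add[symmetric] field_simps power2_eq_square)
  show "integrable std_normal_distribution (\<lambda>x. exp (c * x))"
    by (subst integrable_density) (auto simp: eq simp del: real_scaleR_def)
  show "(\<integral>x. exp (c * x) \<partial>std_normal_distribution) = exp (c\<^sup>2 / 2)"
    by (subst integral_density) (auto simp: eq simp del: real_scaleR_def)
qed

lemma prob_space_std_normal: "prob_space std_normal_distribution"
  using real_dist_normal_dist by (simp add: real_distribution_def)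

lemma prob_space_std_gaussian: "prob_space (std_gaussian n)"
  unfolding std_gaussian_def by (intro prob_space_PiM prob_space_std_normal)

lemma sets_std_gaussian [measurable_cong]:
  "sets (std_gaussian n) = sets (Pi\<^sub>M {..<n} (\<lambda>_. borel))"
  unfolding std_gaussian_def by (intro sets_PiM_cong) auto

lemma measurable_gaussian_functional [measurable]:
  "(\<lambda>z. \<Sum>i<n. c i * z i) \<in> borel_measurable (std_gaussian n)"
  by measurable

lemma gaussian_mgf:
  shows integrable_gaussian_exp: "integrable (std_gaussian n) (\<lambda>z. exp (\<Sum>i<n. c i * z i))"
    and integral_gaussian_exp:
      "(\<integral>z. exp (\<Sum>i<n. c i * z i) \<partial>std_gaussian n) = exp ((\<Sum>i<n. (c i)\<^sup>2) / 2)"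
proof -
  interpret product_prob_space "\<lambda>_::nat. std_normal_distribution"
    by (simp add: product_prob_space_def product_prob_space_axioms_def product_sigma_finite_def
        prob_space_std_normal prob_space_imp_sigma_finite)
  show "integrable (std_gaussian n) (\<lambda>z. exp (\<Sum>i<n. c i * z i))"
    unfolding std_gaussian_def exp_sum[OF finite_lessThan]
    by (rule product_integrable_prod) (auto intro: integrable_std_normal_exp)
  show "(\<integral>z. exp (\<Sum>i<n. c i * z i) \<partial>std_gaussian n) = exp ((\<Sum>i<n. (c i)\<^sup>2) / 2)"
    unfolding std_gaussian_def exp_sum[OF finite_lessThan] sum_divide_distrib
    by (subst product_integral_prod) (auto intro: integrable_std_normal_exp simp: integral_std_normal_exp)
qed

lemma gaussian_char:
  "(CLINT z|std_gaussian n. iexp (\<Sum>i<n. c i * z i)) = of_real (exp (- (\<Sum>i<n. (c i)\<^sup>2) / 2))"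
proof -
  interpret product_prob_space "\<lambda>_::nat. std_normal_distribution"
    by (simp add: product_prob_space_def product_prob_space_axioms_def product_sigma_finite_def
        prob_space_std_normal prob_space_imp_sigma_finite)
  have eq: "iexp (\<Sum>i<n. c i * z i) = (\<Prod>i<n. iexp (c i * z i))" for z :: "nat \<Rightarrow> real"
    by (simp add: exp_sum[OF finite_lessThan, symmetric] sum_distrib_left)
  have one: "(CLINT x|std_normal_distribution. iexp (c * x)) = of_real (exp (- (c\<^sup>2) / 2))" for c
    using fun_cong[OF char_std_normal_distribution, of c] by (simp add: char_def)
  have "(CLINT z|std_gaussian n. iexp (\<Sum>i<n. c i * z i)) = (\<Prod>i<n. of_real (exp (- ((c i)\<^sup>2) / 2)))"
    unfolding std_gaussian_def eq
    by (subst product_integral_prod) (auto intro!: finite_measure.integrable_const_bound[where B=1]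
          prob_space.finite_measure prob_space_std_normal simp: one[simplified])
  also have "\<dots> = of_real (exp (- (\<Sum>i<n. (c i)\<^sup>2) / 2))"
    by (simp add: exp_sum[OF finite_lessThan, symmetric] sum_divide_distrib sum_negf
        of_real_prod[symmetric] del: of_real_prod)
  finally show ?thesis .
qed

text \<open>Levy's uniqueness theorem for a law reweighted by a density \<open>w\<close>. The weights make it
  possible to reduce statements about the joint law of two variables to uniqueness on the real line.\<close>

lemma weighted_law_std_normal:
  fixes w V :: "'a \<Rightarrow> real"
  assumes "prob_space M" and [measurable]: "V \<in> borel_measurable M" "w \<in> borel_measurable M"
    and nonneg: "\<And>z. 0 \<le> w z" and int: "integrable M w"
    and char: "\<And>t. (CLINT z|M. of_real (w z) * iexp (t * V z)) = of_real (exp (- (t\<^sup>2) / 2))"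
    and [measurable]: "A \<in> sets borel"
  shows "(\<integral>z. w z * indicator A (V z) \<partial>M) = measure std_normal_distribution A"
proof -
  define N where "N = distr (density M w) borel V"
  have one: "(\<integral>z. w z \<partial>M) = 1"
    using char[of 0] int by (simp add: of_real_eq_1_iff)
  have "emeasure (density M w) (space (density M w)) = 1"
    using one int nonneg
    by (simp add: emeasure_density nn_integral_eq_integral cong: nn_integral_cong_simp)
  then interpret D: prob_space "density M w" by (rule prob_spaceI)
  have rd: "real_distribution N"
    unfolding N_def by (rule D.real_distribution_distr) simp
  have "Characteristic_Functions.char N = Characteristic_Functions.char std_normal_distribution"
    unfolding char_std_normal_distribution
  proof
    fix t
    show "Characteristic_Functions.char N t = of_real (exp (- (t\<^sup>2) / 2))"
      unfolding char_def N_def using nonneg char[of t]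
      by (simp add: integral_distr integral_density scaleR_conv_of_real)
  qed
  then have eq: "N = std_normal_distribution"
    using Levy_uniqueness[OF rd real_dist_normal_dist] by simp
  have "measure std_normal_distribution A = (\<integral>x. indicator A x \<partial>N)"
    by (simp add: eq)
  also have "\<dots> = (\<integral>z. w z * indicator A (V z) \<partial>M)"
    unfolding N_def using nonneg
    by (subst integral_distr, simp, simp, subst integral_density) auto
  finally show ?thesis by simp
qed

text \<open>The joint characteristic function of the two functionals factorises. Uniqueness is then used
  twice: \<open>V\<close> stays standard normal under the weights \<open>1 + cos (s * U)\<close> (normalised) and
  \<open>1 + sin (s * U)\<close>, which determines the characteristic function of \<open>U\<close> on the event \<open>V \<in> B\<close>; and
  \<open>U\<close> reweighted by the indicator of this event is again standard normal.\<close>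

lemma gaussian_orthonormal_independent:
  assumes c: "(\<Sum>i<n. (c i)\<^sup>2) = 1" and d: "(\<Sum>i<n. (d i)\<^sup>2) = 1" and cd: "(\<Sum>i<n. c i * d i) = 0"
    and Av: "A \<in> sets borel" and Bv: "B \<in> sets borel"
  shows "(\<integral>z. indicator A (\<Sum>i<n. c i * z i) * indicator B (\<Sum>i<n. d i * z i) \<partial>std_gaussian n)
         = measure std_normal_distribution A * measure std_normal_distribution B"
proof -
  note [measurable] = Av Bv
  interpret prob_space "std_gaussian n" by (rule prob_space_std_gaussian)
  define U where "U z = (\<Sum>i<n. c i * z i)" for z :: "nat \<Rightarrow> real"
  define V where "V z = (\<Sum>i<n. d i * z i)" for z :: "nat \<Rightarrow> real"
  have [measurable]: "U \<in> borel_measurable (std_gaussian n)" "V \<in> borel_measurable (std_gaussian n)"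
    unfolding U_def V_def by measurable
  have joint: "(CLINT z|std_gaussian n. iexp (s * U z + t * V z)) = of_real (exp (- (s\<^sup>2 + t\<^sup>2) / 2))" for s t
  proof -
    have "s * U z + t * V z = (\<Sum>i<n. (s * c i + t * d i) * z i)" for z
      by (simp add: U_def V_def sum_distrib_left sum.distrib[symmetric] algebra_simps)
    moreover have "(\<Sum>i<n. (s * c i + t * d i)\<^sup>2)
        = s\<^sup>2 * (\<Sum>i<n. (c i)\<^sup>2) + t\<^sup>2 * (\<Sum>i<n. (d i)\<^sup>2) + 2 * s * t * (\<Sum>i<n. c i * d i)"
      by (simp add: sum_distrib_left sum.distrib[symmetric] power2_eq_square algebra_simps)
    ultimately show ?thesis
      using gaussian_char[of n "\<lambda>i. s * c i + t * d i"] by (simp add: c d cd)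
  qed
  have int [simp]: "integrable (std_gaussian n) (\<lambda>z. iexp (s * U z + t * V z))" for s t
    by (intro integrable_iexp) auto
  have cosE: "of_real (cos (s * U z)) * iexp (t * V z)
      = (iexp (s * U z + t * V z) + iexp ((-s) * U z + t * V z)) / 2" for s t z
    by (simp add: cos_of_real[symmetric] cos_exp_eq exp_add[symmetric] exp_diff[symmetric] algebra_simps
        add_divide_distrib del: cos_of_real)
  have sinE: "of_real (sin (s * U z)) * iexp (t * V z)
      = (iexp (s * U z + t * V z) - iexp ((-s) * U z + t * V z)) / (2 * \<i>)" for s t z
    by (simp add: sin_of_real[symmetric] sin_exp_eq exp_add[symmetric] exp_diff[symmetric] algebra_simps
        diff_divide_distrib del: sin_of_real)
  define E where "E s = exp (- (s\<^sup>2) / 2)" for s :: real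
  have cos_char: "(CLINT z|std_gaussian n. of_real (cos (s * U z)) * iexp (t * V z)) = of_real (E s * E t)" for s t
    unfolding cosE using joint[of s t] joint[of "-s" t] int[of s t] int[of "-s" t]
    by (simp add: E_def exp_add[symmetric] add_divide_distrib)
  have sin_char: "(CLINT z|std_gaussian n. of_real (sin (s * U z)) * iexp (t * V z)) = 0" for s t
    unfolding sinE using joint[of s t] joint[of "-s" t] int[of s t] int[of "-s" t]
    by simp
  have bnd [simp]: "integrable (std_gaussian n) (\<lambda>z. of_real (f z) * iexp (t * V z))" 
    if "f \<in> borel_measurable (std_gaussian n)" "\<And>z. \<bar>f z\<bar> \<le> 1" for f :: "_ \<Rightarrow> real" and t
    using that by (intro integrable_const_bound[where B=1]) (auto simp: norm_mult)
  have bnd' [simp]: "integrable (std_gaussian n) f" 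
    if "f \<in> borel_measurable (std_gaussian n)" "\<And>z. \<bar>f z\<bar> \<le> 1" for f :: "_ \<Rightarrow> real"
    using that by (intro integrable_const_bound[where B=1]) (auto simp: norm_mult)
  have V_char: "(CLINT z|std_gaussian n. iexp (t * V z)) = of_real (E t)" for t
    using joint[of 0 t] by (simp add: E_def)
  have V_law: "(\<integral>z. indicator B (V z) \<partial>std_gaussian n) = measure std_normal_distribution B"
    using weighted_law_std_normal[of "std_gaussian n" V "\<lambda>_. 1" B] V_char prob_space_std_gaussian
    by (simp add: E_def)
  have ind [simp]: "integrable (std_gaussian n) (\<lambda>z. f z * indicator B (V z))" 
    if "f \<in> borel_measurable (std_gaussian n)" "\<And>z. \<bar>f z\<bar> \<le> 1" for f :: "_ \<Rightarrow> real"
    using that by (intro bnd') (auto simp: indicator_def)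
  have nn: "0 \<le> 1 + cos x" "0 \<le> 1 + sin x" for x :: real
    using cos_ge_minus_one[of x] sin_ge_minus_one[of x] by linarith+
  have cos_B: "(\<integral>z. cos (s * U z) * indicator B (V z) \<partial>std_gaussian n) = E s * measure std_normal_distribution B" for s
  proof -
    have E: "0 < E s" by (simp add: E_def)
    have "(\<integral>z. (1 + cos (s * U z)) / (1 + E s) * indicator B (V z) \<partial>std_gaussian n) = measure std_normal_distribution B"
    proof (rule weighted_law_std_normal[OF prob_space_std_gaussian])
      fix t
      have "(CLINT z|std_gaussian n. of_real (1 + cos (s * U z)) * iexp (t * V z)) = of_real ((1 + E s) * E t)"
        using cos_char[of s t] V_char[of t] bnd[of "\<lambda>_. 1" t] bnd[of "\<lambda>z. cos (s * U z)" t] by (simp add: ring_distribs)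
      then have "(CLINT z|std_gaussian n. of_real (1 + cos (s * U z)) * iexp (t * V z) / of_real (1 + E s)) = of_real (E t)"
        using E by (simp add: add_pos_pos  del: of_real_add)
      then show "(CLINT z|std_gaussian n. of_real ((1 + cos (s * U z)) / (1 + E s)) * iexp (t * V z)) = of_real (exp (- (t\<^sup>2) / 2))"
        by (simp add: E_def)
    qed (use E nn in \<open>auto intro!: divide_nonneg_nonneg\<close>)
    then have "(\<integral>z. (indicator B (V z) + cos (s * U z) * indicator B (V z)) / (1 + E s) \<partial>std_gaussian n) = measure std_normal_distribution B"
      by (simp add: ring_distribs add_divide_distrib del: Bochner_Integration.integral_add Bochner_Integration.integral_divide_zero)
    then have "(\<integral>z. indicator B (V z) + cos (s * U z) * indicator B (V z) \<partial>std_gaussian n) = (1 + E s) * measure std_normal_distribution B"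
      using E by (simp add: field_simps)
    then show ?thesis using ind[of "\<lambda>_. 1"] by (simp add: V_law ring_distribs)
  qed
  have sin_B: "(\<integral>z. sin (s * U z) * indicator B (V z) \<partial>std_gaussian n) = 0" for s
  proof -
    have "(\<integral>z. (1 + sin (s * U z)) * indicator B (V z) \<partial>std_gaussian n) = measure std_normal_distribution B"
    proof (rule weighted_law_std_normal[OF prob_space_std_gaussian])
      fix t
      show "(CLINT z|std_gaussian n. of_real (1 + sin (s * U z)) * iexp (t * V z)) = of_real (exp (- (t\<^sup>2) / 2))"
        using sin_char[of s t] V_char[of t] bnd[of "\<lambda>_. 1" t] bnd[of "\<lambda>z. sin (s * U z)" t] by (simp add: ring_distribs E_def)
    qed (use nn in auto)
    then show ?thesis using ind[of "\<lambda>_. 1"] by (simp add: V_law ring_distribs)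
  qed
  show ?thesis
  proof (cases "measure std_normal_distribution B = 0")
    case True
    have "(\<integral>z. indicat_real A (U z) * indicat_real B (V z) \<partial>std_gaussian n) \<le> (\<integral>z. indicat_real B (V z) \<partial>std_gaussian n)"
      using ind[of "\<lambda>_. 1"] ind[of "\<lambda>z. indicat_real A (U z)"] by (intro integral_mono) (auto simp: indicator_def)
    moreover have "0 \<le> (\<integral>z. indicat_real A (U z) * indicat_real B (V z) \<partial>std_gaussian n)"
      by (intro Bochner_Integration.integral_nonneg) auto
    ultimately have "(\<integral>z. indicat_real A (U z) * indicat_real B (V z) \<partial>std_gaussian n) = 0"
      using True V_law by linarith
    then show ?thesis using True by (simp add: U_def V_def)
  next
    case False
    let ?m = "measure std_normal_distribution B"
    have "(\<integral>z. indicator B (V z) / ?m * indicator A (U z) \<partial>std_gaussian n) = measure std_normal_distribution A"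
    proof (rule weighted_law_std_normal[OF prob_space_std_gaussian])
      show "integrable (std_gaussian n) (\<lambda>z. indicator B (V z) / ?m)"
        using ind[of "\<lambda>_. 1"] by simp
      fix t
      have "(CLINT z|std_gaussian n. of_real (indicator B (V z)) * iexp (t * U z))
          = (CLINT z|std_gaussian n. of_real (cos (t * U z) * indicator B (V z)) + \<i> * of_real (sin (t * U z) * indicator B (V z)))"
        by (intro Bochner_Integration.integral_cong refl)
          (auto simp: indicator_def exp_Euler cos_of_real sin_of_real simp flip: of_real_mult)
      also have "\<dots> = of_real (E t * ?m)"
        by (subst Bochner_Integration.integral_add)
          (use cos_B[of t] sin_B[of t] in \<open>auto simp del: of_real_mult\<close>)
      finally have "(CLINT z|std_gaussian n. of_real (indicator B (V z)) * iexp (t * U z) / of_real ?m) = of_real (E t)"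
        using False by simp
      then show "(CLINT z|std_gaussian n. of_real (indicator B (V z) / ?m) * iexp (t * U z)) = of_real (exp (- (t\<^sup>2) / 2))"
        by (simp add: E_def)
    qed auto
    then show ?thesis using False by (simp add: field_simps U_def V_def)
  qed
qed

abbreviation gaussian_tail :: "real \<Rightarrow> real" where
  "gaussian_tail u \<equiv> measure std_normal_distribution {u..}"

lemma prob_gaussian_functional_ge:
  assumes c: "(\<Sum>i<n. (c i)\<^sup>2) = 1"
  shows "(\<integral>z. indicator {u..} (\<Sum>i<n. c i * z i) \<partial>std_gaussian n) = gaussian_tail u"
proof -
  have "(CLINT z|std_gaussian n. iexp (t * (\<Sum>i<n. c i * z i))) = of_real (exp (- (t\<^sup>2) / 2))" for t
    using gaussian_char[of n "\<lambda>i. t * c i"] c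
    by (simp add: sum_distrib_left mult.assoc power_mult_distrib flip: sum_distrib_left[of "t\<^sup>2"])
  then show ?thesis
    using weighted_law_std_normal[of "std_gaussian n" "\<lambda>z. \<Sum>i<n. c i * z i" "\<lambda>_. 1" "{u..}"]
      prob_space_std_gaussian prob_space.finite_measure[OF prob_space_std_gaussian]
    by (simp add: finite_measure.integrable_const)
qed

text \<open>For nearly uncorrelated functionals the joint tail is almost the product of the tails.
  Split \<open>V\<close> into its component \<open>\<rho> * U\<close> along \<open>U\<close> and an independent rest: unless \<open>U\<close> exceeds \<open>R\<close>, the first
  component is at most \<open>\<eta> * R\<close>, so the rest has to exceed \<open>u - \<eta> * R\<close>.\<close>

lemma prob_gaussian_pair_ge:
  assumes c: "(\<Sum>i<n. (c i)\<^sup>2) = 1" and d: "(\<Sum>i<n. (d i)\<^sup>2) = 1"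
    and cd: "\<bar>\<Sum>i<n. c i * d i\<bar> \<le> \<eta>" and \<eta>: "\<eta> < 1" and u: "0 \<le> u" and R: "0 \<le> R" "\<eta> * R \<le> u"
  shows "(\<integral>z. indicator {u..} (\<Sum>i<n. c i * z i) * indicator {u..} (\<Sum>i<n. d i * z i) \<partial>std_gaussian n)
         \<le> gaussian_tail R + gaussian_tail u * gaussian_tail (u - \<eta> * R)"
proof -
  interpret prob_space "std_gaussian n" by (rule prob_space_std_gaussian)
  define \<rho> where "\<rho> = (\<Sum>i<n. c i * d i)"
  define \<sigma> where "\<sigma> = sqrt (1 - \<rho>\<^sup>2)"
  have \<rho>: "\<bar>\<rho>\<bar> \<le> \<eta>" "\<rho>\<^sup>2 < 1" using cd \<eta> by (auto simp: \<rho>_def abs_square_less_1)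
  have \<sigma>: "0 < \<sigma>" "\<sigma> \<le> 1" "\<sigma>\<^sup>2 = 1 - \<rho>\<^sup>2" using \<rho> by (auto simp: \<sigma>_def)
  define e where "e i = (d i - \<rho> * c i) / \<sigma>" for i
  have "(\<Sum>i<n. (d i - \<rho> * c i)\<^sup>2) = (\<Sum>i<n. (d i)\<^sup>2) - 2 * \<rho> * (\<Sum>i<n. c i * d i) + \<rho>\<^sup>2 * (\<Sum>i<n. (c i)\<^sup>2)"
    by (simp add: sum_distrib_left sum.distrib[symmetric] sum_subtractf[symmetric] power2_eq_square algebra_simps)
  then have "(\<Sum>i<n. (d i - \<rho> * c i)\<^sup>2) = \<sigma>\<^sup>2"
    unfolding c d \<rho>_def[symmetric] \<sigma> by (simp add: power2_eq_square)
  then have e: "(\<Sum>i<n. (e i)\<^sup>2) = 1"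
    using \<sigma> \<rho> by (simp add: e_def power_divide flip: sum_divide_distrib)
  have "(\<Sum>i<n. c i * (d i - \<rho> * c i)) = (\<Sum>i<n. c i * d i) - \<rho> * (\<Sum>i<n. (c i)\<^sup>2)"
    by (simp add: sum_distrib_left sum_subtractf[symmetric] power2_eq_square algebra_simps)
  then have ce: "(\<Sum>i<n. c i * e i) = 0"
    by (simp add: c e_def \<rho>_def flip: sum_divide_distrib)
  define U where "U z = (\<Sum>i<n. c i * z i)" for z :: "nat \<Rightarrow> real"
  define V where "V z = (\<Sum>i<n. d i * z i)" for z :: "nat \<Rightarrow> real"
  define W where "W z = (\<Sum>i<n. e i * z i)" for z :: "nat \<Rightarrow> real"
  have [measurable]: "U \<in> borel_measurable (std_gaussian n)" "V \<in> borel_measurable (std_gaussian n)"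
     "W \<in> borel_measurable (std_gaussian n)"
    unfolding U_def V_def W_def by measurable
  have V: "V z = \<rho> * U z + \<sigma> * W z" for z
  proof -
    have "d i * z i = \<rho> * (c i * z i) + \<sigma> * (e i * z i)" for i
      using \<sigma> by (simp add: e_def field_simps)
    then show ?thesis
      by (simp add: U_def V_def W_def sum_distrib_left sum.distrib)
  qed
  have pt: "indicat_real {u..} (U z) * indicat_real {u..} (V z)
      \<le> indicat_real {R..} (U z) + indicat_real {u..} (U z) * indicat_real {u - \<eta> * R..} (W z)" for z
  proof (cases "u \<le> U z \<and> u \<le> V z \<and> U z < R")
    case True
    have "\<rho> * U z \<le> \<eta> * R"
      using True \<rho> u R by (meson abs_le_D1 abs_ge_zero less_imp_le mult_mono order_trans)
    then have *: "u - \<eta> * R \<le> \<sigma> * W z" using True V[of z] by linarith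
    then have "0 \<le> W z" using R \<sigma> by (smt (verit) mult_pos_neg)
    then have "\<sigma> * W z \<le> W z" using \<sigma> by (simp add: mult_left_le_one_le)
    then show ?thesis using * True by (auto simp: indicator_def)
  qed (auto simp: indicator_def)
  have "(\<integral>z. indicat_real {u..} (U z) * indicat_real {u..} (V z) \<partial>std_gaussian n)
      \<le> (\<integral>z. indicat_real {R..} (U z) + indicat_real {u..} (U z) * indicat_real {u - \<eta> * R..} (W z) \<partial>std_gaussian n)"
    by (intro integral_mono pt Bochner_Integration.integrable_add integrable_const_bound[where B=1])
      (auto simp: indicator_def)
  also have "\<dots> = (\<integral>z. indicat_real {R..} (U z) \<partial>std_gaussian n)
      + (\<integral>z. indicat_real {u..} (U z) * indicat_real {u - \<eta> * R..} (W z) \<partial>std_gaussian n)"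
    by (intro Bochner_Integration.integral_add integrable_const_bound[where B=1]) (auto simp: indicator_def)
  also have "\<dots> = gaussian_tail R + gaussian_tail u * gaussian_tail (u - \<eta> * R)"
    using prob_gaussian_functional_ge[OF c, of R]
      gaussian_orthonormal_independent[OF c e ce, of "{u..}" "{u - \<eta> * R..}"]
    by (simp add: U_def W_def)
  finally show ?thesis by (simp add: U_def V_def)
qed

text \<open>Chernoff bound with the exponential tilt \<open>u\<close>.\<close>

lemma gaussian_tail_le:
  assumes "0 \<le> u"
  shows "gaussian_tail u \<le> exp (- (u\<^sup>2) / 2)"
proof -
  interpret N: prob_space std_normal_distribution by (rule prob_space_std_normal)
  have "gaussian_tail u = (\<integral>x. indicator {u..} x \<partial>std_normal_distribution)"
    by simp
  also have "\<dots> \<le> (\<integral>x. exp (- (u\<^sup>2)) * exp (u * x) \<partial>std_normal_distribution)"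
  proof (rule integral_mono)
    show "integrable std_normal_distribution (indicat_real {u..})"
      by (rule N.integrable_const_bound[where B=1]) auto
    show "integrable std_normal_distribution (\<lambda>x. exp (- (u\<^sup>2)) * exp (u * x))"
      by (intro integrable_mult_right integrable_std_normal_exp)
    show "indicat_real {u..} x \<le> exp (- (u\<^sup>2)) * exp (u * x)" for x
      using assms by (auto simp: indicator_def exp_add[symmetric] power2_eq_square mult_left_mono)
  qed
  also have "\<dots> = exp (- (u\<^sup>2) / 2)"
    by (subst Bochner_Integration.integral_mult_right_zero, subst integral_std_normal_exp)
      (simp add: exp_add[symmetric])
  finally show ?thesis .
qed

lemma std_normal_interval:
  assumes "0 \<le> u" "u \<le> v"
  shows std_normal_interval_ge: "(v - u) * std_normal_density v \<le> measure std_normal_distribution {u..v}"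
    and std_normal_interval_le: "measure std_normal_distribution {u..v} \<le> (v - u) * std_normal_density u"
proof -
  have eq: "measure std_normal_distribution {u..v} = (\<integral>x. std_normal_density x * indicator {u..v} x \<partial>lborel)"
  proof -
    have "measure std_normal_distribution {u..v} = (\<integral>x. indicator {u..v} x \<partial>std_normal_distribution)"
      by simp
    also have "\<dots> = (\<integral>x. std_normal_density x * indicator {u..v} x \<partial>lborel)"
      by (subst integral_density) auto
    finally show ?thesis .
  qed
  have dec: "std_normal_density y \<le> std_normal_density x" if "0 \<le> x" "x \<le> y" for x y
    using that by (auto simp: normal_density_def divide_right_mono power_mono)
  have const: "(\<integral>x. c * indicator {u..v} x \<partial>lborel) = (v - u) * c" "integrable lborel (\<lambda>x. c * indicat_real {u..v} x)" for c :: real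
    using assms by auto
  have int: "integrable lborel (\<lambda>x. std_normal_density x * indicator {u..v} x)"
    by (intro integrable_real_mult_indicator) auto
  show "(v - u) * std_normal_density v \<le> measure std_normal_distribution {u..v}"
    unfolding eq const(1)[symmetric] using assms
    by (intro integral_mono int const(2)) (auto simp: indicator_def dec)
  show "measure std_normal_distribution {u..v} \<le> (v - u) * std_normal_density u"
    unfolding eq const(1)[symmetric] using assms
    by (intro integral_mono int const(2)) (auto simp: indicator_def dec)
qed

lemma gaussian_tail_ge:
  assumes "0 \<le> u"
  shows "std_normal_density (u + 1) \<le> gaussian_tail u"
proof -
  have "std_normal_density (u + 1) \<le> measure std_normal_distribution {u..u+1}"
    using std_normal_interval_ge[of u "u + 1"] assms by simp
  also have "\<dots> \<le> gaussian_tail u"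
    by (intro finite_measure.finite_measure_mono prob_space.finite_measure prob_space_std_normal) auto
  finally show ?thesis .
qed

lemma gaussian_tail_shift_le:
  assumes "0 \<le> e" "e \<le> u"
  shows "gaussian_tail (u - e) \<le> gaussian_tail u + e * std_normal_density (u - e)"
proof -
  have "gaussian_tail (u - e) \<le> measure std_normal_distribution ({u..} \<union> {u - e..u})"
    by (intro finite_measure.finite_measure_mono prob_space.finite_measure prob_space_std_normal) auto
  also have "\<dots> \<le> gaussian_tail u + measure std_normal_distribution {u - e..u}"
    by (intro measure_Un_le) auto
  also have "\<dots> \<le> gaussian_tail u + e * std_normal_density (u - e)"
    using std_normal_interval_le[of "u - e" u] assms by simp
  finally show ?thesis .
qed

section \<open>Extreme eigenvalues of the Gram matrix\<close>

lemma compact_box: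
  fixes M :: real
  shows "compact {f :: nat \<Rightarrow> real. \<forall>i. f i \<in> (if i < p then {-M..M} else {0})}"
proof -
  have "compactin (product_topology (\<lambda>_. euclidean) UNIV)
      (PiE UNIV (\<lambda>i. if i < p then {-M..M} else {0::real}))"
    unfolding compactin_PiE by auto
  moreover have "PiE UNIV (\<lambda>i. if i < p then {-M..M} else {0::real})
      = {f. \<forall>i. f i \<in> (if i < p then {-M..M} else {0})}"
    by (auto simp: PiE_def Pi_def)
  ultimately show ?thesis
    by (simp add: euclidean_product_topology del: if_split)
qed

text \<open>A minimiser \<open>v\<close> of the quadratic form on the unit sphere is an eigenvector: otherwise moving
  from \<open>v\<close> against the residual \<open>r = A v - l * v\<close> would make the form minus \<open>l\<close> times the squared norm negative.
  Vectors are functions on all of \<open>nat\<close>, so the sphere is cut out of the compact box of functions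
  vanishing from \<open>p\<close> on.\<close>

lemma symmetric_min_eigenpair:
  fixes A :: "nat \<Rightarrow> nat \<Rightarrow> real"
  assumes sym: "\<And>i j. i < p \<Longrightarrow> j < p \<Longrightarrow> A i j = A j i" and p: "0 < p"
  obtains v l where "\<exists>j<p. v j \<noteq> 0" "\<And>i. i < p \<Longrightarrow> (\<Sum>j<p. A i j * v j) = l * v i"
    "\<And>h. l * (\<Sum>j<p. (h j)\<^sup>2) \<le> (\<Sum>i<p. \<Sum>j<p. h i * A i j * h j)"
proof -
  define q where "q h = (\<Sum>i<p. \<Sum>j<p. h i * A i j * h j)" for h
  define N where "N h = (\<Sum>j<p. (h j)\<^sup>2)" for h :: "nat \<Rightarrow> real"
  define S where "S = {f :: nat \<Rightarrow> real. \<forall>i. f i \<in> (if i < p then {-1..1} else {0})} \<inter> {f. N f = 1}"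
  have cont: "continuous_on T (\<lambda>f. f i)" for T :: "(nat \<Rightarrow> real) set" and i
    by (rule continuous_on_subset[OF continuous_on_product_coordinates]) auto
  have "closed {f. N f = 1}"
    unfolding N_def by (intro closed_Collect_eq continuous_intros cont)
  then have "compact S" unfolding S_def by (intro compact_Int_closed compact_box)
  moreover have "(\<lambda>j. if j = 0 then 1 else 0) \<in> S"
    using p by (auto simp: S_def N_def if_distrib[of "\<lambda>x. x\<^sup>2"] cong: if_cong)
  moreover have "continuous_on S q"
    unfolding q_def by (intro continuous_intros cont)
  ultimately obtain v where v: "v \<in> S" "\<And>f. f \<in> S \<Longrightarrow> q v \<le> q f"
    using continuous_attains_inf[of S q] by blast
  define l where "l = q v"
  have Nv: "N v = 1" using v(1) by (simp add: S_def)
  have min: "l * N h \<le> q h" for h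
  proof (cases "N h = 0")
    case True
    then have "\<And>j. j < p \<Longrightarrow> h j = 0" by (simp add: N_def sum_nonneg_eq_0_iff)
    then have "q h = 0" by (simp add: q_def)
    then show ?thesis using True by simp
  next
    case False
    then have pos: "0 < N h" by (simp add: N_def less_le sum_nonneg)
    define g where "g j = (if j < p then h j / sqrt (N h) else 0)" for j
    have "N g = N h / N h"
      using pos by (simp add: N_def[of g] g_def power_divide N_def[of h] flip: sum_divide_distrib)
    then have Ng: "N g = 1" using pos by simp
    have "(g j)\<^sup>2 \<le> 1" if "j < p" for j
      using member_le_sum[of j "{..<p}" "\<lambda>j. (g j)\<^sup>2"] that Ng by (simp add: N_def)
    then have "\<bar>g j\<bar> \<le> 1" if "j < p" for j using that by (simp add: abs_square_le_1)
    moreover have "g j = 0" if "\<not> j < p" for j using that by (simp add: g_def)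
    ultimately have "g \<in> S" using Ng by (auto simp: S_def abs_le_iff minus_le_iff)
    then have "l \<le> q g" using v by (simp add: l_def)
    also have "q g = (\<Sum>i<p. \<Sum>j<p. h i * A i j * h j / N h)"
      unfolding q_def using pos by (intro sum.cong refl) (simp add: g_def field_simps)
    also have "\<dots> = q h / N h"
      by (simp add: q_def sum_divide_distrib)
    finally show ?thesis using pos by (simp add: field_simps)
  qed
  define r where "r i = (\<Sum>j<p. A i j * v j) - l * v i" for i
  have expand: "q (\<lambda>i. v i + t * r i) - l * N (\<lambda>i. v i + t * r i)
      = 2 * t * N r + t\<^sup>2 * (q r - l * N r)" for t
  proof -
    have "q (\<lambda>i. v i + t * r i) = q v + t * (\<Sum>i<p. \<Sum>j<p. r i * A i j * v j)
        + t * (\<Sum>i<p. \<Sum>j<p. v i * A i j * r j) + t\<^sup>2 * q r"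
      by (simp add: q_def sum_distrib_left sum.distrib[symmetric] power2_eq_square algebra_simps)
    also have "(\<Sum>i<p. \<Sum>j<p. v i * A i j * r j) = (\<Sum>i<p. \<Sum>j<p. r i * A i j * v j)"
      by (subst sum.swap, intro sum.cong refl) (simp add: sym)
    also have "(\<Sum>i<p. \<Sum>j<p. r i * A i j * v j) = N r + l * (\<Sum>i<p. v i * r i)"
    proof -
      have "(\<Sum>i<p. \<Sum>j<p. r i * A i j * v j) = (\<Sum>i<p. r i * (r i + l * v i))"
        by (simp add: r_def[of _] mult.assoc flip: sum_distrib_left)
      then show ?thesis
        by (simp add: N_def sum_distrib_left sum.distrib power2_eq_square algebra_simps)
    qed
    finally have 1: "q (\<lambda>i. v i + t * r i) = l + 2 * t * (N r + l * (\<Sum>i<p. v i * r i)) + t\<^sup>2 * q r"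
      by (simp add: l_def)
    have 2: "N (\<lambda>i. v i + t * r i) = N v + 2 * t * (\<Sum>i<p. v i * r i) + t\<^sup>2 * N r"
      by (simp add: N_def sum_distrib_left sum.distrib[symmetric] power2_eq_square algebra_simps)
    show ?thesis unfolding 1 2 Nv by (simp add: algebra_simps)
  qed
  have "N r = 0"
  proof (rule ccontr)
    assume nz: "N r \<noteq> 0"
    define c where "c = q r - l * N r"
    have c: "0 \<le> c" using min[of r] by (simp add: c_def)
    \<comment> \<open>the step length \<open>- e\<close> nearly minimises the quadratic polynomial in \<open>expand\<close>,
      and \<open>c + 1\<close> instead of \<open>c\<close> covers the case \<open>c = 0\<close>\<close>
    define e where "e = N r / (c + 1)"
    have e: "N r = e * (c + 1)" using c by (simp add: e_def)
    have "0 \<le> 2 * (- e) * N r + (- e)\<^sup>2 * c"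
      using min[of "\<lambda>i. v i + (- e) * r i"] expand[of "- e"] by (simp add: c_def)
    also have "\<dots> = - (e\<^sup>2 * (c + 2))"
      unfolding e by (simp add: algebra_simps power2_eq_square)
    also have "\<dots> < 0" using c nz e by (auto simp: zero_less_mult_iff)
    finally show False by simp
  qed
  then have "\<And>i. i < p \<Longrightarrow> r i = 0" by (simp add: N_def sum_nonneg_eq_0_iff)
  then have eig: "\<And>i. i < p \<Longrightarrow> (\<Sum>j<p. A i j * v j) = l * v i" by (simp add: r_def)
  have "\<exists>j<p. v j \<noteq> 0"
  proof (rule ccontr)
    assume "\<not> (\<exists>j<p. v j \<noteq> 0)"
    then have "N v = 0" by (simp add: N_def)
    then show False using Nv by simp
  qed
  then show thesis using that eig min by (auto simp: q_def N_def)
qed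

lemma gram_entry:
  assumes "X \<in> carrier_mat n p" "i < p" "j < p"
  shows "gram X $$ (i, j) = (\<Sum>k<n. X $$ (k, i) * X $$ (k, j)) / real n"
  using assms by (auto simp: gram_def scalar_prod_def atLeast0LessThan)

lemma eigenvalue_gramI:
  assumes X: "X \<in> carrier_mat n p" and nz: "\<exists>j<p. v j \<noteq> 0"
    and eig: "\<And>i. i < p \<Longrightarrow> (\<Sum>j<p. gram X $$ (i, j) * v j) = l * v i"
  shows "eigenvalue (gram X) l"
proof -
  have dim: "dim_row (gram X) = p" "dim_col (gram X) = p" using X by (auto simp: gram_def)
  have "eigenvector (gram X) (Matrix.vec p v) l"
    unfolding eigenvector_def
  proof (intro conjI)
    show "Matrix.vec p v \<in> carrier_vec (dim_row (gram X))" by (simp add: dim)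
    show "Matrix.vec p v \<noteq> 0\<^sub>v (dim_row (gram X))"
      using nz by (metis dim(1) index_vec index_zero_vec(1))
    show "gram X *\<^sub>v Matrix.vec p v = l \<cdot>\<^sub>v Matrix.vec p v"
      by (rule eq_vecI) (auto simp: dim scalar_prod_def atLeast0LessThan eig[symmetric])
  qed
  then show ?thesis by (auto simp: eigenvalue_def)
qed

lemma design_quadratic_form:
  assumes X: "X \<in> carrier_mat n p" and n: "0 < n"
  shows "(\<Sum>i<n. (\<Sum>j<p. X $$ (i, j) * h j)\<^sup>2)
         = real n * (\<Sum>i<p. \<Sum>j<p. h i * gram X $$ (i, j) * h j)"
proof -
  have "(\<Sum>k<n. (\<Sum>j<p. X $$ (k, j) * h j)\<^sup>2)
      = (\<Sum>k<n. \<Sum>i<p. \<Sum>j<p. (X $$ (k, i) * h i) * (X $$ (k, j) * h j))"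
    by (simp add: power2_eq_square sum_product)
  also have "\<dots> = (\<Sum>i<p. \<Sum>j<p. \<Sum>k<n. (X $$ (k, i) * h i) * (X $$ (k, j) * h j))"
    by (simp only: sum.swap[of _ "{..<p}" "{..<n}"])
  also have "\<dots> = (\<Sum>i<p. \<Sum>j<p. real n * (h i * gram X $$ (i, j) * h j))"
  proof (intro sum.cong refl)
    fix i j assume ij: "i \<in> {..<p}" "j \<in> {..<p}"
    have "(\<Sum>k<n. (X $$ (k, i) * h i) * (X $$ (k, j) * h j))
        = h i * h j * (\<Sum>k<n. X $$ (k, i) * X $$ (k, j))"
      by (simp add: sum_distrib_left mult_ac)
    then show "(\<Sum>k<n. (X $$ (k, i) * h i) * (X $$ (k, j) * h j)) = real n * (h i * gram X $$ (i, j) * h j)"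
      using n ij by (simp add: gram_entry[OF X])
  qed
  finally show ?thesis by (simp add: sum_distrib_left)
qed

lemma design_norm_bounds:
  assumes X: "X \<in> carrier_mat n p" and n: "0 < n" and p: "0 < p"
    and a: "smallest_eigenvalue (gram X) a" and b: "largest_eigenvalue (gram X) b"
  shows design_norm_ge: "a * real n * (\<Sum>j<p. (h j)\<^sup>2) \<le> (\<Sum>i<n. (\<Sum>j<p. X $$ (i, j) * h j)\<^sup>2)"
    and design_norm_le: "(\<Sum>i<n. (\<Sum>j<p. X $$ (i, j) * h j)\<^sup>2) \<le> b * real n * (\<Sum>j<p. (h j)\<^sup>2)"
proof -
  have sym: "gram X $$ (i, j) = gram X $$ (j, i)" if "i < p" "j < p" for i j
    using that by (simp add: gram_entry[OF X] mult.commute)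
  obtain v l where v: "\<exists>j<p. v j \<noteq> 0" "\<And>i. i < p \<Longrightarrow> (\<Sum>j<p. gram X $$ (i, j) * v j) = l * v i"
    "\<And>h. l * (\<Sum>j<p. (h j)\<^sup>2) \<le> (\<Sum>i<p. \<Sum>j<p. h i * gram X $$ (i, j) * h j)"
    by (rule symmetric_min_eigenpair[of p "\<lambda>i j. gram X $$ (i, j)"]) (use sym p in auto)
  have "a \<le> l" using a eigenvalue_gramI[OF X v(1,2)] by (auto simp: smallest_eigenvalue_def)
  then have "a * (\<Sum>j<p. (h j)\<^sup>2) \<le> (\<Sum>i<p. \<Sum>j<p. h i * gram X $$ (i, j) * h j)"
    using v(3)[of h] by (meson mult_right_mono order_trans sum_nonneg zero_le_power2)
  then show "a * real n * (\<Sum>j<p. (h j)\<^sup>2) \<le> (\<Sum>i<n. (\<Sum>j<p. X $$ (i, j) * h j)\<^sup>2)"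
    unfolding design_quadratic_form[OF X n] using n by (simp add: mult.left_commute mult.assoc)
  \<comment> \<open>the largest eigenvalue is handled as the smallest one of the negated matrix\<close>
  obtain v l where v: "\<exists>j<p. v j \<noteq> 0" "\<And>i. i < p \<Longrightarrow> (\<Sum>j<p. - gram X $$ (i, j) * v j) = l * v i"
    "\<And>h. l * (\<Sum>j<p. (h j)\<^sup>2) \<le> (\<Sum>i<p. \<Sum>j<p. h i * - gram X $$ (i, j) * h j)"
    by (rule symmetric_min_eigenpair[of p "\<lambda>i j. - gram X $$ (i, j)"]) (use sym p in auto)
  have "(\<Sum>j<p. gram X $$ (i, j) * v j) = - l * v i" if "i < p" for i
    using v(2)[OF that] by (simp add: sum_negf)
  then have "- l \<le> b" using b eigenvalue_gramI[OF X v(1), of "- l"] by (auto simp: largest_eigenvalue_def)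
  then have "- l * (\<Sum>j<p. (h j)\<^sup>2) \<le> b * (\<Sum>j<p. (h j)\<^sup>2)"
    by (intro mult_right_mono sum_nonneg) auto
  moreover have "(\<Sum>i<p. \<Sum>j<p. h i * gram X $$ (i, j) * h j) \<le> - l * (\<Sum>j<p. (h j)\<^sup>2)"
    using v(3)[of h] by (simp add: sum_negf)
  ultimately have "(\<Sum>i<p. \<Sum>j<p. h i * gram X $$ (i, j) * h j) \<le> b * (\<Sum>j<p. (h j)\<^sup>2)" by simp
  then show "(\<Sum>i<n. (\<Sum>j<p. X $$ (i, j) * h j)\<^sup>2) \<le> b * real n * (\<Sum>j<p. (h j)\<^sup>2)"
    unfolding design_quadratic_form[OF X n] using n by (simp add: mult.left_commute mult.assoc)
qed

section \<open>The maximiser of the localised width\<close>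

lemma integrable_gaussian_coordinate:
  assumes "k < n"
  shows "integrable (std_gaussian n) (\<lambda>z. z k)"
proof -
  have coord: "(\<Sum>i<n. (if i = k then s else 0) * z i) = s * z k" for s and z :: "nat \<Rightarrow> real"
  proof -
    have "(\<Sum>i<n. (if i = k then s else 0) * z i) = (\<Sum>i<n. if i = k then s * z k else 0)"
      by (intro sum.cong) auto
    then show ?thesis using assms by simp
  qed
  have e: "integrable (std_gaussian n) (\<lambda>z. exp (s * z k))" for s
    using integrable_gaussian_exp[of n "\<lambda>i. if i = k then s else 0"] unfolding coord .
  have [measurable]: "(\<lambda>z. z k) \<in> borel_measurable (std_gaussian n)"
    using measurable_gaussian_functional[of "\<lambda>i. if i = k then 1 else 0" n] unfolding coord by simp
  have "\<bar>x\<bar> \<le> exp x + exp (- x)" for x :: real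
    using exp_ge_add_one_self[of x] exp_ge_add_one_self[of "- x"] exp_gt_zero[of x] exp_gt_zero[of "- x"]
    by linarith
  then show ?thesis
    using e[of 1] e[of "-1"]
    by (intro Bochner_Integration.integrable_bound[OF Bochner_Integration.integrable_add[OF e[of 1] e[of "-1"]]])
      (auto intro: order_trans abs_ge_self)
qed

text \<open>\<open>D\<close> plays the role of \<open>K - \<mu>\<close>, and \<open>h0\<close> that of the translated projection of \<open>\<mu>\<close> onto \<open>K\<close>.\<close>

locale gaussian_width =
  fixes n :: nat and D :: "(nat \<Rightarrow> real) set" and M :: real and h0 :: "nat \<Rightarrow> real"
  assumes bound: "h \<in> D \<Longrightarrow> L2_set h {..<n} \<le> M"
    and convex: "g \<in> D \<Longrightarrow> h \<in> D \<Longrightarrow> 0 \<le> l \<Longrightarrow> l \<le> 1 \<Longrightarrow> (\<lambda>i. (1 - l) * g i + l * h i) \<in> D"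
    and h0: "h0 \<in> D" and h0_min: "h \<in> D \<Longrightarrow> L2_set h0 {..<n} \<le> L2_set h {..<n}"
begin

definition slice :: "real \<Rightarrow> (nat \<Rightarrow> real) set" where
  "slice t = {h \<in> D. L2_set h {..<n} \<le> t}"

definition gsup :: "real \<Rightarrow> (nat \<Rightarrow> real) \<Rightarrow> real" where
  "gsup t z = (SUP h\<in>slice t. \<Sum>i<n. z i * h i)"

definition width :: "real \<Rightarrow> real" where
  "width t = (\<integral>z. gsup t z \<partial>std_gaussian n)"

definition profile :: "real \<Rightarrow> ereal" where
  "profile t = (if slice t = {} then - \<infinity> else ereal (width t - t\<^sup>2 / 2))"

definition t0 :: real where "t0 = L2_set h0 {..<n}"

lemma t0_nonneg: "0 \<le> t0" by (simp add: t0_def)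

lemma M_ge_t0: "t0 \<le> M" using bound[OF h0] by (simp add: t0_def)

lemma slice_nonempty_iff: "slice t \<noteq> {} \<longleftrightarrow> t0 \<le> t"
proof
  assume "slice t \<noteq> {}"
  then obtain h where "h \<in> D" "L2_set h {..<n} \<le> t" by (auto simp: slice_def)
  then show "t0 \<le> t" using h0_min[of h] by (simp add: t0_def)
next
  assume "t0 \<le> t"
  then have "h0 \<in> slice t" using h0 by (simp add: slice_def t0_def)
  then show "slice t \<noteq> {}" by auto
qed

lemma abs_inner_le: "\<bar>\<Sum>i<n. z i * h i\<bar> \<le> (\<Sum>i<n. \<bar>z i\<bar>) * L2_set h {..<n}"
proof -
  have "\<bar>h i\<bar> \<le> L2_set h {..<n}" if "i < n" for i
    using member_le_L2_set[of "{..<n}" i "\<lambda>i. \<bar>h i\<bar>"] that by (simp add: L2_set_def)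
  then have "\<bar>\<Sum>i<n. z i * h i\<bar> \<le> (\<Sum>i<n. \<bar>z i\<bar> * L2_set h {..<n})"
    by (intro sum_abs[THEN order_trans] sum_mono) (auto simp: abs_mult mult_left_mono)
  then show ?thesis by (simp add: sum_distrib_right)
qed

lemma inner_le_M: "h \<in> D \<Longrightarrow> (\<Sum>i<n. z i * h i) \<le> (\<Sum>i<n. \<bar>z i\<bar>) * M"
  using abs_inner_le[of z h] bound[of h] mult_left_mono[OF bound[of h], of "\<Sum>i<n. \<bar>z i\<bar>"]
  by (simp add: sum_nonneg abs_le_iff)

lemma gsup_upper: "h \<in> slice t \<Longrightarrow> (\<Sum>i<n. z i * h i) \<le> gsup t z"
  unfolding gsup_def by (rule cSUP_upper) (auto intro!: bdd_aboveI2 inner_le_M simp: slice_def)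

lemma gsup_least:
  "t0 \<le> t \<Longrightarrow> (\<And>h. h \<in> slice t \<Longrightarrow> (\<Sum>i<n. z i * h i) \<le> B) \<Longrightarrow> gsup t z \<le> B"
  unfolding gsup_def by (rule cSUP_least) (auto simp: slice_nonempty_iff)

lemma gsup_lipschitz:
  assumes "t0 \<le> t"
  shows "gsup t z \<le> gsup t y + (\<Sum>i<n. \<bar>z i - y i\<bar>) * M"
proof (rule gsup_least[OF assms])
  fix h assume h: "h \<in> slice t"
  have "(\<Sum>i<n. z i * h i) = (\<Sum>i<n. y i * h i) + (\<Sum>i<n. (z i - y i) * h i)"
    by (simp add: sum.distrib[symmetric] algebra_simps)
  also have "\<dots> \<le> gsup t y + (\<Sum>i<n. \<bar>z i - y i\<bar>) * M"
    using h by (intro add_mono gsup_upper inner_le_M) (auto simp: slice_def)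
  finally show "(\<Sum>i<n. z i * h i) \<le> gsup t y + (\<Sum>i<n. \<bar>z i - y i\<bar>) * M" .
qed

text \<open>The supremum runs over an uncountable set. It is measurable because it is Lipschitz in the first
  \<open>n\<close> coordinates, hence continuous for the product topology on all sequences; \<open>ext\<close> transports this to
  the finite product space.\<close>

lemma measurable_gsup:
  assumes "t0 \<le> t"
  shows "gsup t \<in> borel_measurable (std_gaussian n)"
proof -
  have cont: "continuous_on UNIV (gsup t)"
    unfolding continuous_on_def
  proof
    fix y :: "nat \<Rightarrow> real"
    have "continuous_on UNIV (\<lambda>z :: nat \<Rightarrow> real. (\<Sum>i<n. \<bar>z i - y i\<bar>) * M)"
      by (intro continuous_intros) auto
    then have "((\<lambda>z :: nat \<Rightarrow> real. (\<Sum>i<n. \<bar>z i - y i\<bar>) * M) \<longlongrightarrow> (\<Sum>i<n. \<bar>y i - y i\<bar>) * M) (at y within UNIV)"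
      unfolding continuous_on_def by blast
    then have lim: "((\<lambda>z :: nat \<Rightarrow> real. (\<Sum>i<n. \<bar>z i - y i\<bar>) * M) \<longlongrightarrow> 0) (at y within UNIV)"
      by simp
    have "norm (gsup t z - gsup t y) \<le> (\<Sum>i<n. \<bar>z i - y i\<bar>) * M" for z
      using gsup_lipschitz[OF assms, of z y] gsup_lipschitz[OF assms, of y z]
      by (simp add: abs_le_iff abs_minus_commute)
    then have "((\<lambda>z. gsup t z - gsup t y) \<longlongrightarrow> 0) (at y within UNIV)"
      by (intro Lim_null_comparison[OF _ lim]) auto
    then show "(gsup t \<longlongrightarrow> gsup t y) (at y within UNIV)"
      by (rule LIM_zero_cancel)
  qed
  define ext where "ext z i = (if i < n then z i else 0)" for z :: "nat \<Rightarrow> real" and i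
  have "ext \<in> borel_measurable (std_gaussian n)"
  proof (rule measurable_coordinatewise_then_product)
    fix i show "(\<lambda>z. ext z i) \<in> borel_measurable (std_gaussian n)"
      by (cases "i < n") (auto simp: ext_def)
  qed
  then have "(\<lambda>z. gsup t (ext z)) \<in> borel_measurable (std_gaussian n)"
    using measurable_compose borel_measurable_continuous_onI[OF cont] by blast
  moreover have "gsup t (ext z) = gsup t z" for z
    by (simp add: gsup_def ext_def)
  ultimately show ?thesis by (simp add: fun_eq_iff cong: measurable_cong)
qed

lemma integrable_abs_sum: "integrable (std_gaussian n) (\<lambda>z. \<Sum>i<n. \<bar>z i\<bar>)"
  by (intro Bochner_Integration.integrable_sum integrable_abs integrable_gaussian_coordinate) auto

lemma integrable_gsup:
  assumes "t0 \<le> t"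
  shows "integrable (std_gaussian n) (gsup t)"
proof -
  have "\<bar>gsup t z\<bar> \<le> (\<Sum>i<n. \<bar>z i\<bar>) * M" for z
    using gsup_lipschitz[OF assms, of z "\<lambda>_. 0"] gsup_lipschitz[OF assms, of "\<lambda>_. 0" z] assms
    by (simp add: gsup_def slice_nonempty_iff abs_le_iff)
  moreover have "0 \<le> M" using M_ge_t0 t0_nonneg by linarith
  ultimately show ?thesis
    by (intro Bochner_Integration.integrable_bound[OF integrable_mult_left[OF integrable_abs_sum, of M]]
        measurable_gsup[OF assms]) (auto simp: sum_nonneg)
qed

lemma width_mono:
  assumes "t0 \<le> s" "s \<le> t"
  shows "width s \<le> width t"
  unfolding width_def
proof (intro integral_mono integrable_gsup gsup_least)
  fix z h assume "h \<in> slice s"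
  then show "(\<Sum>i<n. z i * h i) \<le> gsup t z" using assms by (intro gsup_upper) (auto simp: slice_def)
qed (use assms in auto)

text \<open>By convexity of \<open>D\<close>, the slices of radii \<open>s\<close> and \<open>t\<close> mix into the slice of the mixed radius.\<close>

lemma width_concave:
  assumes s: "t0 \<le> s" and t: "t0 \<le> t" and l: "0 < l" "l < 1"
  shows "(1 - l) * width s + l * width t \<le> width ((1 - l) * s + l * t)"
proof -
  let ?r = "(1 - l) * s + l * t"
  have "(1 - l) * t0 + l * t0 \<le> ?r" using assms by (intro add_mono mult_left_mono) auto
  then have r: "t0 \<le> ?r" by (simp add: algebra_simps)
  have comb: "(1 - l) * (\<Sum>i<n. z i * g i) + l * (\<Sum>i<n. z i * h i) \<le> gsup ?r z"
    if g: "g \<in> slice s" and h: "h \<in> slice t" for z g h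
  proof -
    let ?c = "\<lambda>i. (1 - l) * g i + l * h i"
    have "L2_set ?c {..<n} \<le> L2_set (\<lambda>i. (1 - l) * g i) {..<n} + L2_set (\<lambda>i. l * h i) {..<n}"
      by (rule L2_set_triangle_ineq)
    also have "\<dots> = (1 - l) * L2_set g {..<n} + l * L2_set h {..<n}"
      using l by (simp add: L2_set_right_distrib)
    also have "\<dots> \<le> ?r" using g h l by (intro add_mono mult_left_mono) (auto simp: slice_def)
    finally have "?c \<in> slice ?r" using convex[of g h l] g h l by (auto simp: slice_def)
    from gsup_upper[OF this, of z] show ?thesis
      by (simp add: sum_distrib_left sum.distrib[symmetric] algebra_simps)
  qed
  have "(1 - l) * gsup s z + l * gsup t z \<le> gsup ?r z" for z
  proof -
    have l': "0 < 1 - l" using l by simp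
    define G where "G = gsup ?r z"
    have "gsup t z * l \<le> G - (\<Sum>i<n. z i * g i) * (1 - l)" if g: "g \<in> slice s" for g
      unfolding pos_le_divide_eq[OF l(1), symmetric]
    proof (rule gsup_least[OF t])
      fix h assume "h \<in> slice t"
      from comb[OF g this, of z]
      show "(\<Sum>i<n. z i * h i) \<le> (G - (\<Sum>i<n. z i * g i) * (1 - l)) / l"
        unfolding pos_le_divide_eq[OF l(1)] G_def by (simp only: mult.commute)
    qed
    note inner = this
    have "gsup s z * (1 - l) \<le> G - gsup t z * l"
      unfolding pos_le_divide_eq[OF l', symmetric]
    proof (rule gsup_least[OF s])
      fix g assume "g \<in> slice s"
      from inner[OF this] show "(\<Sum>i<n. z i * g i) \<le> (G - gsup t z * l) / (1 - l)"
        unfolding pos_le_divide_eq[OF l'] by linarith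
    qed
    then show ?thesis unfolding G_def by (simp only: mult.commute)
  qed
  then have "(\<integral>z. (1 - l) * gsup s z + l * gsup t z \<partial>std_gaussian n) \<le> width ?r"
    unfolding width_def
    by (intro integral_mono integrable_gsup r Bochner_Integration.integrable_add integrable_mult_right s t)
  then show ?thesis
    using integrable_gsup[OF s] integrable_gsup[OF t] by (simp add: width_def)
qed

text \<open>Pythagoras' inequality for a projection: the minimality of \<open>h0\<close> on the segment from \<open>h0\<close> to \<open>h\<close>
  makes the angle at \<open>h0\<close> obtuse.\<close>

lemma norm_diff_h0:
  assumes "h \<in> D"
  shows "(L2_set (\<lambda>i. h i - h0 i) {..<n})\<^sup>2 \<le> (L2_set h {..<n})\<^sup>2 - t0\<^sup>2"
proof -
  define a where "a = (\<Sum>i<n. h0 i * (h i - h0 i))"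
  define b where "b = (\<Sum>i<n. (h i - h0 i)\<^sup>2)"
  define c where "c = (\<Sum>i<n. (h0 i)\<^sup>2)"
  have "0 \<le> b" by (simp add: b_def sum_nonneg)
  have sq: "(\<Sum>i<n. (h0 i + l * (h i - h0 i))\<^sup>2) = c + 2 * l * a + l\<^sup>2 * b" for l
    unfolding a_def b_def c_def
    by (simp add: sum_distrib_left sum.distrib[symmetric] power2_eq_square algebra_simps)
  have "0 \<le> 2 * a + l * b" if l: "0 < l" "l \<le> 1" for l
  proof -
    have "(\<lambda>i. h0 i + l * (h i - h0 i)) \<in> D"
      using convex[OF h0 assms, of l] l by (simp add: algebra_simps)
    from h0_min[OF this] have "c \<le> (\<Sum>i<n. (h0 i + l * (h i - h0 i))\<^sup>2)"
      by (simp add: L2_set_def c_def)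
    then have "c \<le> c + 2 * l * a + l\<^sup>2 * b" by (simp only: sq)
    moreover have "2 * l * a + l\<^sup>2 * b = (2 * a + l * b) * l"
      by (simp add: power2_eq_square distrib_right)
    ultimately have "0 * l \<le> (2 * a + l * b) * l" by linarith
    then show "0 \<le> 2 * a + l * b" using l(1) by (rule mult_right_le_imp_le)
  qed
  note pos = this
  have "0 \<le> a"
  proof (rule ccontr)
    assume "\<not> 0 \<le> a"
    define l where "l = min 1 (- a / (b + 1))"
    have "0 < - a / (b + 1)" using \<open>\<not> 0 \<le> a\<close> \<open>0 \<le> b\<close> by (intro divide_pos_pos) auto
    then have l: "0 < l" "l \<le> 1" by (auto simp: l_def)
    have "l * b \<le> - a / (b + 1) * b" using \<open>0 \<le> b\<close> by (intro mult_right_mono) (auto simp: l_def)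
    also have "\<dots> = - a * (b / (b + 1))" by simp
    also have "\<dots> \<le> - a * 1" using \<open>0 \<le> b\<close> \<open>\<not> 0 \<le> a\<close> by (intro mult_left_mono) auto
    finally show False using pos[OF l] \<open>\<not> 0 \<le> a\<close> by linarith
  qed
  moreover have "(\<Sum>i<n. (h i)\<^sup>2) = c + 2 * a + b" using sq[of 1] by simp
  moreover have "(L2_set f {..<n})\<^sup>2 = (\<Sum>i<n. (f i)\<^sup>2)" for f
    by (simp add: L2_set_def sum_nonneg)
  ultimately show ?thesis
    by (simp add: t0_def b_def c_def)
qed

text \<open>Concavity says nothing about continuity at the left end point \<open>t0\<close>. There the slice shrinks to
  \<open>h0\<close>, at the rate given by the preceding inequality.\<close>

lemma width_near_t0:
  assumes "t0 \<le> t"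
  shows "width t \<le> width t0 + (\<integral>z. (\<Sum>i<n. \<bar>z i\<bar>) \<partial>std_gaussian n) * sqrt (t\<^sup>2 - t0\<^sup>2)"
proof -
  have "gsup t z \<le> gsup t0 z + (\<Sum>i<n. \<bar>z i\<bar>) * sqrt (t\<^sup>2 - t0\<^sup>2)" for z
  proof (rule gsup_least[OF assms])
    fix h assume h: "h \<in> slice t"
    have "(L2_set h {..<n})\<^sup>2 \<le> t\<^sup>2" using h by (intro power_mono) (auto simp: slice_def)
    then have "L2_set (\<lambda>i. h i - h0 i) {..<n} \<le> sqrt (t\<^sup>2 - t0\<^sup>2)"
      using norm_diff_h0[of h] h by (intro real_le_rsqrt) (auto simp: slice_def)
    then have "(\<Sum>i<n. z i * (h i - h0 i)) \<le> (\<Sum>i<n. \<bar>z i\<bar>) * sqrt (t\<^sup>2 - t0\<^sup>2)"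
      using abs_inner_le[of z "\<lambda>i. h i - h0 i"] mult_left_mono[of _ _ "\<Sum>i<n. \<bar>z i\<bar>"]
      by (fastforce simp: sum_nonneg abs_le_iff)
    moreover have "(\<Sum>i<n. z i * h0 i) \<le> gsup t0 z"
      using h0 by (intro gsup_upper) (auto simp: slice_def t0_def)
    moreover have "(\<Sum>i<n. z i * h i) = (\<Sum>i<n. z i * h0 i) + (\<Sum>i<n. z i * (h i - h0 i))"
      by (simp add: sum.distrib[symmetric] algebra_simps)
    ultimately show "(\<Sum>i<n. z i * h i) \<le> gsup t0 z + (\<Sum>i<n. \<bar>z i\<bar>) * sqrt (t\<^sup>2 - t0\<^sup>2)"
      by linarith
  qed
  then have "width t \<le> (\<integral>z. gsup t0 z + (\<Sum>i<n. \<bar>z i\<bar>) * sqrt (t\<^sup>2 - t0\<^sup>2) \<partial>std_gaussian n)"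
    unfolding width_def
    by (intro integral_mono integrable_gsup assms Bochner_Integration.integrable_add integrable_mult_left
        integrable_abs_sum) auto
  then show ?thesis
    using integrable_gsup[of t0] integrable_abs_sum by (simp add: width_def)
qed

lemma continuous_on_width: "continuous_on {t0..} width"
proof -
  have "concave_on {t0<..} width"
    by (rule concave_on_linorderI) (use width_concave in auto)
  then have "continuous_on {t0<..} (\<lambda>t. - width t)"
    by (intro convex_on_continuous) (auto simp: concave_on_def)
  then have "continuous_on {t0<..} width"
    using continuous_on_minus[of "{t0<..}" "\<lambda>t. - width t"] by simp
  moreover have "(width \<longlongrightarrow> width t0) (at t0 within {t0..})"
  proof (rule tendsto_sandwich)
    show "\<forall>\<^sub>F t in at t0 within {t0..}. width t0 \<le> width t"
      by (auto simp: eventually_at_filter intro!: always_eventually width_mono)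
    show "\<forall>\<^sub>F t in at t0 within {t0..}. width t
        \<le> width t0 + (\<integral>z. (\<Sum>i<n. \<bar>z i\<bar>) \<partial>std_gaussian n) * sqrt (t\<^sup>2 - t0\<^sup>2)"
      by (auto simp: eventually_at_filter intro!: always_eventually width_near_t0)
    have "((\<lambda>t. width t0 + (\<integral>z. (\<Sum>i<n. \<bar>z i\<bar>) \<partial>std_gaussian n) * sqrt (t\<^sup>2 - t0\<^sup>2))
       \<longlongrightarrow> width t0 + (\<integral>z. (\<Sum>i<n. \<bar>z i\<bar>) \<partial>std_gaussian n) * sqrt (t0\<^sup>2 - t0\<^sup>2)) (at t0 within {t0..})"
      by (intro tendsto_intros)
    then show "((\<lambda>t. width t0 + (\<integral>z. (\<Sum>i<n. \<bar>z i\<bar>) \<partial>std_gaussian n) * sqrt (t\<^sup>2 - t0\<^sup>2))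
       \<longlongrightarrow> width t0) (at t0 within {t0..})" by simp
  qed auto
  ultimately show ?thesis
    unfolding continuous_on_def
  proof (intro ballI)
    fix t assume 1: "\<forall>x\<in>{t0<..}. (width \<longlongrightarrow> width x) (at x within {t0<..})"
      and 2: "(width \<longlongrightarrow> width t0) (at t0 within {t0..})" and t: "t \<in> {t0..}"
    show "(width \<longlongrightarrow> width t) (at t within {t0..})"
    proof (cases "t = t0")
      case False
      then have t': "t \<in> {t0<..}" using t by simp
      have "(width \<longlongrightarrow> width t) (at t)"
        using bspec[OF 1 t'] at_within_open[OF t'] by simp
      then show ?thesis by (rule tendsto_within_subset) simp
    qed (use 2 in simp)
  qed
qed

lemma width_stable:
  assumes "M \<le> t"
  shows "width t = width M"
proof -
  have "slice t = slice M" using assms bound order_trans[OF bound assms] by (auto simp: slice_def)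
  then show ?thesis by (simp add: width_def gsup_def)
qed

lemma profile_eq: "t0 \<le> t \<Longrightarrow> profile t = ereal (width t - t\<^sup>2 / 2)"
  by (simp add: profile_def slice_nonempty_iff)

lemma profile_below: "t < t0 \<Longrightarrow> profile t = - \<infinity>"
  using slice_nonempty_iff[of t] by (auto simp: profile_def)

text \<open>A maximiser exists since the profile is continuous on \<open>{t0..M}\<close>, equals \<open>- \<infinity>\<close> below \<open>t0\<close> and decreases
  above \<open>M\<close>. It is unique since the concave width minus \<open>t\<^sup>2 / 2\<close> is strictly larger at the midpoint of two
  maximisers.\<close>

lemma ex1_profile_max: "\<exists>!t. 0 \<le> t \<and> (\<forall>t'\<ge>0. profile t' \<le> profile t)"
proof -
  let ?g = "\<lambda>t. width t - t\<^sup>2 / 2"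
  have "continuous_on {t0..M} width"
    by (rule continuous_on_subset[OF continuous_on_width]) auto
  moreover have "continuous_on {t0..M} (\<lambda>t. t\<^sup>2 / 2)"
    by (intro continuous_intros) auto
  ultimately have "continuous_on {t0..M} ?g"
    by (rule continuous_on_diff)
  moreover have "{t0..M} \<noteq> {}" using M_ge_t0 by simp
  ultimately obtain t where t: "t \<in> {t0..M}" "\<And>s. s \<in> {t0..M} \<Longrightarrow> ?g s \<le> ?g t"
    using continuous_attains_sup[OF compact_Icc, of t0 M ?g] by blast
  have max: "profile s \<le> profile t" for s
  proof (cases "t0 \<le> s")
    case True
    have "?g s \<le> ?g t"
    proof (cases "s \<le> M")
      case False
      have "0 \<le> M" using M_ge_t0 t0_nonneg by linarith
      then have "M\<^sup>2 \<le> s\<^sup>2" using False by (intro power_mono) auto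
      then show ?thesis using width_stable[of s] False t(2)[of M] M_ge_t0 by auto
    qed (use t True in auto)
    then show ?thesis using True t by (simp add: profile_eq)
  next
    case False
    then show ?thesis by (simp add: profile_below)
  qed
  show ?thesis
  proof (rule ex1I[of _ t])
    show "0 \<le> t \<and> (\<forall>t'\<ge>0. profile t' \<le> profile t)" using t t0_nonneg max by auto
    fix s assume s: "0 \<le> s \<and> (\<forall>t'\<ge>0. profile t' \<le> profile s)"
    then have "profile t0 \<le> profile s" using t0_nonneg by blast
    then have s0: "t0 \<le> s" using profile_below[of s] profile_eq[of t0] by (cases "t0 \<le> s") auto
    have "0 \<le> t" using t t0_nonneg by auto
    then have "profile t = profile s" using s max[of s] by (intro antisym) auto
    then have eq: "?g s = ?g t" using s0 t by (simp add: profile_eq)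
    show "s = t"
    proof (rule ccontr)
      assume "s \<noteq> t"
      let ?m = "(s + t) / 2"
      have m: "t0 \<le> ?m" using s0 t by auto
      have "?g ?m \<le> ?g t" using max[of ?m] m t by (simp add: profile_eq)
      moreover have "(width s + width t) / 2 \<le> width ?m"
        using width_concave[of s t "1/2"] s0 t by (simp add: field_simps)
      moreover have "?m\<^sup>2 = (s\<^sup>2 + t\<^sup>2) / 2 - ((s - t) / 2)\<^sup>2"
        by (simp add: power2_eq_square field_simps)
      moreover have "0 < ((s - t) / 2)\<^sup>2" using \<open>s \<noteq> t\<close> by simp
      ultimately show False using eq by argo
    qed
  qed
qed


definition argmax :: real where
  "argmax = (THE t. 0 \<le> t \<and> (\<forall>t'\<ge>0. profile t' \<le> profile t))"

lemma argmax_nonneg: "0 \<le> argmax"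
  and profile_le_argmax: "0 \<le> t \<Longrightarrow> profile t \<le> profile argmax"
  using theI'[OF ex1_profile_max] unfolding argmax_def by blast+

lemma argmax_ge: "t0 \<le> argmax"
  using profile_le_argmax[OF t0_nonneg] profile_below[of argmax] profile_eq[of t0]
  by (cases "t0 \<le> argmax") auto

lemma width_argmax: "t0 \<le> t \<Longrightarrow> width t - t\<^sup>2 / 2 \<le> width argmax - argmax\<^sup>2 / 2"
  using profile_le_argmax[of t] t0_nonneg profile_eq[of t] profile_eq[OF argmax_ge] by auto

lemma argmax_le: "argmax \<le> M"
proof (rule ccontr)
  assume *: "\<not> argmax \<le> M"
  have "M\<^sup>2 < argmax\<^sup>2" using * M_ge_t0 t0_nonneg by (intro power_strict_mono) auto
  then show False using width_argmax[OF M_ge_t0] width_stable[of argmax] * by simp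
qed

lemma width_le:
  assumes "t0 \<le> t" and "integrable (std_gaussian n) B"
    and "\<And>z h. h \<in> slice t \<Longrightarrow> (\<Sum>i<n. z i * h i) \<le> B z"
  shows "width t \<le> (\<integral>z. B z \<partial>std_gaussian n)"
  unfolding width_def using assms by (intro integral_mono integrable_gsup gsup_least) auto

lemma width_ge:
  assumes "t0 \<le> t" and "integrable (std_gaussian n) f"
    and "\<And>z. h z \<in> slice t" and "\<And>z. f z \<le> (\<Sum>i<n. z i * h z i)"
  shows "(\<integral>z. f z \<partial>std_gaussian n) \<le> width t"
  unfolding width_def
proof (intro integral_mono integrable_gsup assms(1,2))
  show "f z \<le> gsup t z" for z using assms(4)[of z] gsup_upper[OF assms(3)[of z], of z] by linarith
qed

end

section \<open>Translated images of an l1 ball\<close>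

text \<open>The design matrix has entries \<open>x i j\<close>; vectors are functions of which only the values below the
  dimension matter. The bounds \<open>norm_ge\<close> and \<open>norm_le\<close> express the extreme eigenvalues of the
  Gram matrix, and \<open>columns\<close> its unit diagonal.\<close>

locale lasso_design =
  fixes n p :: nat and x :: "nat \<Rightarrow> nat \<Rightarrow> real" and a b L :: real and \<beta> :: "nat \<Rightarrow> real"
  assumes n: "2 \<le> n" and p: "1 \<le> p" and a: "0 < a" and L: "0 < L"
    and norm_ge: "a * real n * (\<Sum>j<p. (h j)\<^sup>2) \<le> (\<Sum>i<n. (\<Sum>j<p. x i j * h j)\<^sup>2)"
    and norm_le: "(\<Sum>i<n. (\<Sum>j<p. x i j * h j)\<^sup>2) \<le> b * real n * (\<Sum>j<p. (h j)\<^sup>2)"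
    and columns: "j < p \<Longrightarrow> (\<Sum>i<n. (x i j)\<^sup>2) = real n"
begin

definition img :: "(nat \<Rightarrow> real) \<Rightarrow> nat \<Rightarrow> real" where
  "img h i = (\<Sum>j<p. x i j * h j)"

definition shifts :: "(nat \<Rightarrow> real) set" where
  "shifts = {h. (\<Sum>j<p. \<bar>\<beta> j + h j\<bar>) \<le> L}"

definition D :: "(nat \<Rightarrow> real) set" where "D = img ` shifts"

definition l1\<beta> :: real where "l1\<beta> = (\<Sum>j<p. \<bar>\<beta> j\<bar>)"

definition S :: "nat set" where "S = {j. j < p \<and> \<beta> j \<noteq> 0}"

lemma finite_S [simp]: "finite S" by (auto simp: S_def)

lemma n_pos: "0 < real n" using n by simp

lemma L2_ge: "sqrt (a * real n) * L2_set h {..<p} \<le> L2_set (img h) {..<n}"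
  unfolding L2_set_def img_def real_sqrt_mult[symmetric]
  using norm_ge[of h] by (simp only: real_sqrt_le_iff)

lemma L2_le: "L2_set (img h) {..<n} \<le> sqrt (b * real n) * L2_set h {..<p}"
  unfolding L2_set_def img_def real_sqrt_mult[symmetric]
  using norm_le[of h] by (simp only: real_sqrt_le_iff)

lemma b_ge_a: "a \<le> b"
proof -
  have "(\<Sum>j<p. (if j = 0 then 1 else 0 :: real)\<^sup>2) = (\<Sum>j<p. if j = 0 then 1 else 0)"
    by (intro sum.cong) auto
  also have "\<dots> = 1" using p by simp
  finally have "a * real n \<le> b * real n"
    using order_trans[OF norm_ge norm_le, of "\<lambda>j. if j = 0 then 1 else 0"] by simp
  then show ?thesis using n_pos by simp
qed

lemma l1_shift_le: "h \<in> shifts \<Longrightarrow> (\<Sum>j<p. \<bar>h j\<bar>) \<le> L + l1\<beta>"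
proof -
  assume h: "h \<in> shifts"
  have "(\<Sum>j<p. \<bar>h j\<bar>) \<le> (\<Sum>j<p. \<bar>\<beta> j + h j\<bar> + \<bar>\<beta> j\<bar>)" by (intro sum_mono) auto
  then show ?thesis using h by (simp add: shifts_def l1\<beta>_def sum.distrib)
qed

definition M :: real where "M = sqrt (b * real n) * (L + l1\<beta>)"

lemma D_bound: "h \<in> D \<Longrightarrow> L2_set h {..<n} \<le> M"
proof -
  assume "h \<in> D"
  then obtain g where g: "g \<in> shifts" "h = img g" by (auto simp: D_def)
  have "L2_set g {..<p} \<le> L + l1\<beta>"
    using L2_set_le_sum_abs[of g "{..<p}"] l1_shift_le[OF g(1)] by linarith
  then have "sqrt (b * real n) * L2_set g {..<p} \<le> M"
    unfolding M_def using b_ge_a a by (intro mult_left_mono) auto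
  then show ?thesis using L2_le[of g] g by simp
qed

lemma D_convex:
  assumes "g \<in> D" "h \<in> D" "0 \<le> l" "l \<le> 1"
  shows "(\<lambda>i. (1 - l) * g i + l * h i) \<in> D"
proof -
  obtain g' h' where gh: "g' \<in> shifts" "g = img g'" "h' \<in> shifts" "h = img h'"
    using assms by (auto simp: D_def)
  have "(\<Sum>j<p. \<bar>\<beta> j + ((1 - l) * g' j + l * h' j)\<bar>)
      \<le> (\<Sum>j<p. (1 - l) * \<bar>\<beta> j + g' j\<bar> + l * \<bar>\<beta> j + h' j\<bar>)"
  proof (rule sum_mono)
    fix j
    have "\<beta> j + ((1 - l) * g' j + l * h' j) = (1 - l) * (\<beta> j + g' j) + l * (\<beta> j + h' j)"
      by (simp add: algebra_simps)
    then show "\<bar>\<beta> j + ((1 - l) * g' j + l * h' j)\<bar> \<le> (1 - l) * \<bar>\<beta> j + g' j\<bar> + l * \<bar>\<beta> j + h' j\<bar>"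
      using assms abs_triangle_ineq[of "(1 - l) * (\<beta> j + g' j)" "l * (\<beta> j + h' j)"]
      by (simp add: abs_mult)
  qed
  also have "\<dots> = (1 - l) * (\<Sum>j<p. \<bar>\<beta> j + g' j\<bar>) + l * (\<Sum>j<p. \<bar>\<beta> j + h' j\<bar>)"
    by (simp add: sum.distrib sum_distrib_left)
  also have "\<dots> \<le> (1 - l) * L + l * L"
    using gh assms by (intro add_mono mult_left_mono) (auto simp: shifts_def)
  finally have "(\<lambda>j. (1 - l) * g' j + l * h' j) \<in> shifts"
    by (simp add: shifts_def algebra_simps)
  moreover have "(\<lambda>i. (1 - l) * g i + l * h i) = img (\<lambda>j. (1 - l) * g' j + l * h' j)"
    by (simp add: gh img_def fun_eq_iff sum_distrib_left sum.distrib[symmetric] algebra_simps)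
  ultimately show ?thesis by (auto simp: D_def)
qed

text \<open>A projection of \<open>\<mu>\<close> onto \<open>K\<close> exists because the l1 ball, encoded as functions
  vanishing from \<open>p\<close> on, is compact in the product topology.\<close>

lemma D_min_exists: "\<exists>h0\<in>D. \<forall>h\<in>D. L2_set h0 {..<n} \<le> L2_set h {..<n}"
proof -
  define Q where "Q = {f :: nat \<Rightarrow> real. \<forall>i. f i \<in> (if i < p then {-L..L} else {0})} \<inter> {f. (\<Sum>j<p. \<bar>f j\<bar>) \<le> L}"
  define q where "q f = L2_set (img (\<lambda>j. f j - \<beta> j)) {..<n}" for f
  have cont: "continuous_on T (\<lambda>f. f i)" for T :: "(nat \<Rightarrow> real) set" and i
    by (rule continuous_on_subset[OF continuous_on_product_coordinates]) auto
  have "closed {f :: nat \<Rightarrow> real. (\<Sum>j<p. \<bar>f j\<bar>) \<le> L}"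
    by (intro closed_Collect_le continuous_intros cont)
  then have "compact Q" unfolding Q_def by (intro compact_Int_closed compact_box)
  moreover have "(\<lambda>_. 0) \<in> Q" using L by (auto simp: Q_def)
  moreover have "continuous_on Q q"
    unfolding q_def L2_set_def img_def by (intro continuous_intros cont)
  ultimately obtain f where f: "f \<in> Q" "\<And>g. g \<in> Q \<Longrightarrow> q f \<le> q g"
    using continuous_attains_inf[of Q q] by blast
  have "img (\<lambda>j. f j - \<beta> j) \<in> D"
    using f(1) by (auto simp: D_def shifts_def Q_def)
  moreover have "L2_set (img (\<lambda>j. f j - \<beta> j)) {..<n} \<le> L2_set h {..<n}" if h: "h \<in> D" for h
  proof -
    obtain k where k: "k \<in> shifts" "h = img k" using h by (auto simp: D_def)
    define g where "g j = (if j < p then \<beta> j + k j else 0)" for j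
    have sum: "(\<Sum>j<p. \<bar>g j\<bar>) \<le> L" using k by (simp add: g_def shifts_def)
    have "\<bar>g j\<bar> \<le> L" if "j < p" for j
      using member_le_sum[of j "{..<p}" "\<lambda>j. \<bar>g j\<bar>"] that sum by simp
    moreover have "g j = 0" if "\<not> j < p" for j using that by (simp add: g_def)
    ultimately have "g \<in> Q" using sum by (auto simp: Q_def abs_le_iff minus_le_iff)
    moreover have "img (\<lambda>j. g j - \<beta> j) = img k"
      by (simp add: img_def fun_eq_iff g_def)
    ultimately show ?thesis using f(2)[of g] k by (simp add: q_def)
  qed
  ultimately show ?thesis by blast
qed

definition h0 :: "nat \<Rightarrow> real" where
  "h0 = (SOME h0. h0 \<in> D \<and> (\<forall>h\<in>D. L2_set h0 {..<n} \<le> L2_set h {..<n}))"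

lemma h0_D: "h0 \<in> D" and h0_least: "h \<in> D \<Longrightarrow> L2_set h0 {..<n} \<le> L2_set h {..<n}"
  using someI_ex[OF D_min_exists[unfolded Bex_def]] unfolding h0_def by blast+

sublocale gaussian_width n D M h0
  by unfold_locales (fact D_bound D_convex h0_D h0_least)+

definition g :: "nat \<Rightarrow> (nat \<Rightarrow> real) \<Rightarrow> real" where
  "g j z = (\<Sum>i<n. x i j / sqrt (real n) * z i)"

lemma inner_img: "(\<Sum>i<n. z i * img h i) = sqrt (real n) * (\<Sum>j<p. h j * g j z)"
proof -
  have "(\<Sum>i<n. z i * img h i) = (\<Sum>i<n. \<Sum>j<p. h j * (x i j * z i))"
    by (simp add: img_def sum_distrib_left mult_ac)
  also have "\<dots> = (\<Sum>j<p. \<Sum>i<n. h j * (x i j * z i))" by (rule sum.swap)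
  also have "\<dots> = (\<Sum>j<p. sqrt (real n) * (h j * g j z))"
    using n_pos by (intro sum.cong refl) (simp add: g_def sum_distrib_left mult_ac)
  finally show ?thesis by (simp add: sum_distrib_left)
qed

lemma unit_column: "j < p \<Longrightarrow> (\<Sum>i<n. (x i j / sqrt (real n))\<^sup>2) = 1"
  using columns[of j] n_pos by (simp add: power_divide flip: sum_divide_distrib)

lemma g_mgf:
  assumes "j < p"
  shows integrable_exp_g: "integrable (std_gaussian n) (\<lambda>z. exp (c * g j z))"
    and integral_exp_g: "(\<integral>z. exp (c * g j z) \<partial>std_gaussian n) = exp (c\<^sup>2 / 2)"
proof -
  have eq: "c * g j z = (\<Sum>i<n. c * (x i j / sqrt (real n)) * z i)" for z
    by (simp add: g_def sum_distrib_left mult.assoc)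
  have sq: "(\<Sum>i<n. (c * (x i j / sqrt (real n)))\<^sup>2) = c\<^sup>2"
    using unit_column[OF assms] by (simp only: power_mult_distrib sum_distrib_left[symmetric])
  show "integrable (std_gaussian n) (\<lambda>z. exp (c * g j z))"
    unfolding eq by (rule integrable_gaussian_exp)
  show "(\<integral>z. exp (c * g j z) \<partial>std_gaussian n) = exp (c\<^sup>2 / 2)"
    unfolding eq integral_gaussian_exp sq ..
qed

lemma exp_sum_g:
  shows integrable_exp_sum_g:
      "integrable (std_gaussian n) (\<lambda>z. \<Sum>j<p. exp (c * g j z) + exp (- c * g j z))"
    and integral_exp_sum_g:
      "(\<integral>z. (\<Sum>j<p. exp (c * g j z) + exp (- c * g j z)) \<partial>std_gaussian n)
        = 2 * real p * exp (c\<^sup>2 / 2)"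
proof -
  have int: "integrable (std_gaussian n) (\<lambda>z. exp (d * g j z))" if "j < p" for j d
    using integrable_exp_g[OF that] .
  show "integrable (std_gaussian n) (\<lambda>z. \<Sum>j<p. exp (c * g j z) + exp (- c * g j z))"
    by (intro Bochner_Integration.integrable_sum Bochner_Integration.integrable_add int) auto
  have "(\<integral>z. (\<Sum>j<p. exp (c * g j z) + exp (- c * g j z)) \<partial>std_gaussian n)
      = (\<Sum>j<p. exp (c\<^sup>2 / 2) + exp ((- c)\<^sup>2 / 2))"
  proof (subst Bochner_Integration.integral_sum)
    show "integrable (std_gaussian n) (\<lambda>z. exp (c * g j z) + exp (- c * g j z))"
      if "j \<in> {..<p}" for j
      using that int[of j c] int[of j "- c"] by (intro Bochner_Integration.integrable_add) auto
    show "(\<Sum>j<p. \<integral>z. exp (c * g j z) + exp (- c * g j z) \<partial>std_gaussian n)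
        = (\<Sum>j<p. exp (c\<^sup>2 / 2) + exp ((- c)\<^sup>2 / 2))"
    proof (intro sum.cong refl)
      fix j assume "j \<in> {..<p}"
      then have j: "j < p" by simp
      show "(\<integral>z. exp (c * g j z) + exp (- c * g j z) \<partial>std_gaussian n)
          = exp (c\<^sup>2 / 2) + exp ((- c)\<^sup>2 / 2)"
        by (subst Bochner_Integration.integral_add[OF int[OF j] int[OF j]])
          (simp only: integral_exp_g[OF j])
    qed
  qed
  also have "\<dots> = 2 * real p * exp (c\<^sup>2 / 2)" by simp
  finally show "(\<integral>z. (\<Sum>j<p. exp (c * g j z) + exp (- c * g j z)) \<partial>std_gaussian n)
      = 2 * real p * exp (c\<^sup>2 / 2)" .
qed

definition maxrate :: real where "maxrate = sqrt (2 * ln (2 * real p))"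

lemma maxrate_pos: "0 < maxrate" using p by (simp add: maxrate_def)

text \<open>An integrable bound for all \<open>\<bar>g j\<bar>\<close> at once whose mean is the usual \<open>sqrt (2 * ln (2 * p))\<close>. With
  \<open>E\<close> the sum of the \<open>2 * p\<close> exponentials and \<open>A\<close> its mean, \<open>maxrate * \<bar>g j\<bar> \<le> ln E \<le> ln A + E / A - 1\<close>: the
  tangent of the logarithm at \<open>A\<close> replaces Jensen's inequality. The choice of \<open>maxrate\<close> gives
  \<open>ln A = maxrate\<^sup>2\<close>.\<close>

definition maxbound :: "(nat \<Rightarrow> real) \<Rightarrow> real" where
  "maxbound z = (maxrate\<^sup>2 - 1 + (\<Sum>j<p. exp (maxrate * g j z) + exp (- maxrate * g j z))
     / (2 * real p * exp (maxrate\<^sup>2 / 2))) / maxrate"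

lemma integrable_maxbound: "integrable (std_gaussian n) maxbound"
proof -
  interpret prob_space "std_gaussian n" by (rule prob_space_std_gaussian)
  show ?thesis
    unfolding maxbound_def[abs_def]
    by (intro integrable_divide_zero Bochner_Integration.integrable_add integrable_exp_sum_g
        Bochner_Integration.integrable_diff) auto
qed

lemma integral_maxbound: "(\<integral>z. maxbound z \<partial>std_gaussian n) = maxrate"
proof -
  interpret prob_space "std_gaussian n" by (rule prob_space_std_gaussian)
  have "(\<integral>z. maxbound z \<partial>std_gaussian n)
      = (maxrate\<^sup>2 - 1 + (\<integral>z. (\<Sum>j<p. exp (maxrate * g j z) + exp (- maxrate * g j z)) \<partial>std_gaussian n)
          / (2 * real p * exp (maxrate\<^sup>2 / 2))) / maxrate"
    unfolding maxbound_def
    by (subst integral_divide_zero, subst Bochner_Integration.integral_add)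
      (use integrable_exp_sum_g[of maxrate] prob_space
        in \<open>auto simp del: Bochner_Integration.integral_sum Bochner_Integration.integral_add\<close>)
  also have "\<dots> = maxrate"
    unfolding integral_exp_sum_g using p maxrate_pos by (simp add: power2_eq_square)
  finally show ?thesis .
qed

lemma g_le_maxbound:
  assumes "j < p"
  shows "\<bar>g j z\<bar> \<le> maxbound z"
proof -
  define A where "A = 2 * real p * exp (maxrate\<^sup>2 / 2)"
  define E where "E = (\<Sum>j<p. exp (maxrate * g j z) + exp (- maxrate * g j z))"
  have A: "0 < A" using p by (simp add: A_def)
  have "maxrate\<^sup>2 = 2 * ln (2 * real p)" using p by (simp add: maxrate_def)
  then have lnA: "ln A = maxrate\<^sup>2"
    using p by (simp add: A_def ln_mult)
  have "exp (maxrate * \<bar>g j z\<bar>) \<le> exp (maxrate * g j z) + exp (- maxrate * g j z)"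
    by (auto simp: abs_if add_increasing add_increasing2)
  also have "\<dots> \<le> E" unfolding E_def
    by (rule member_le_sum[of j _ "\<lambda>j. exp (maxrate * g j z) + exp (- maxrate * g j z)"])
      (use assms in \<open>auto simp: add_nonneg_nonneg\<close>)
  finally have E: "exp (maxrate * \<bar>g j z\<bar>) \<le> E" .
  then have Epos: "0 < E" using exp_gt_zero less_le_trans by blast
  have "maxrate * \<bar>g j z\<bar> \<le> ln E" using E Epos by (simp add: ln_ge_iff)
  also have "\<dots> = ln A + ln (E / A)" using A Epos by (simp add: ln_div)
  also have "\<dots> \<le> maxrate\<^sup>2 + (E / A - 1)"
    using ln_le_minus_one[of "E / A"] A Epos by (simp add: lnA)
  finally have "\<bar>g j z\<bar> \<le> (maxrate\<^sup>2 + (E / A - 1)) / maxrate"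
    using maxrate_pos by (simp add: pos_le_divide_eq mult.commute)
  then show ?thesis by (simp add: maxbound_def A_def E_def algebra_simps)
qed

lemma width_le_l1:
  assumes t: "t0 \<le> t" and R: "0 \<le> R"
    and l1: "\<And>h. h \<in> shifts \<Longrightarrow> L2_set (img h) {..<n} \<le> t \<Longrightarrow> (\<Sum>j<p. \<bar>h j\<bar>) \<le> R"
  shows "width t \<le> sqrt (real n) * R * maxrate"
proof -
  have mb: "0 \<le> maxbound z" for z using g_le_maxbound[of 0 z] p by simp
  have "(\<Sum>i<n. z i * k i) \<le> sqrt (real n) * R * maxbound z" if k: "k \<in> slice t" for z k
  proof -
    have "k \<in> D" using k by (simp add: slice_def)
    then obtain h where h: "h \<in> shifts" "k = img h" by (auto simp: D_def)
    have "(\<Sum>j<p. h j * g j z) \<le> (\<Sum>j<p. \<bar>h j\<bar> * maxbound z)"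
    proof (intro sum_mono)
      fix j assume "j \<in> {..<p}"
      then have "\<bar>h j\<bar> * \<bar>g j z\<bar> \<le> \<bar>h j\<bar> * maxbound z"
        using g_le_maxbound[of j z] by (intro mult_left_mono) auto
      then show "h j * g j z \<le> \<bar>h j\<bar> * maxbound z" by (simp add: abs_mult[symmetric])
    qed
    also have "\<dots> = (\<Sum>j<p. \<bar>h j\<bar>) * maxbound z" by (simp add: sum_distrib_right)
    also have "\<dots> \<le> R * maxbound z"
      using l1[OF h(1)] h k mb by (intro mult_right_mono) (auto simp: slice_def)
    finally have "sqrt (real n) * (\<Sum>j<p. h j * g j z) \<le> sqrt (real n) * (R * maxbound z)"
      by (intro mult_left_mono) auto
    then show ?thesis by (simp add: h inner_img mult.assoc)
  qed
  then have "width t \<le> (\<integral>z. sqrt (real n) * R * maxbound z \<partial>std_gaussian n)"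
    by (intro width_le t integrable_mult_right integrable_maxbound)
  then show ?thesis by (simp add: integral_maxbound)
qed

end

section \<open>Upper bounds from the geometry of the l1 ball\<close>

context lasso_design begin

definition \<delta> :: real where "\<delta> = L - l1\<beta>"

text \<open>Off the support of \<open>\<beta>\<close> the \<open>l1\<close> norm of \<open>\<beta> + h\<close> grows by all of \<open>\<bar>h j\<bar>\<close>; on the support it drops by at most
  \<open>\<bar>h j\<bar>\<close>. The total growth is at most the slack \<open>\<delta>\<close>.\<close>

lemma l1_shift_le_support:
  assumes "h \<in> shifts"
  shows "(\<Sum>j<p. \<bar>h j\<bar>) \<le> \<delta> + 2 * (\<Sum>j\<in>S. \<bar>h j\<bar>)"
proof -
  have "(\<Sum>j<p. \<bar>h j\<bar>) \<le> (\<Sum>j<p. \<bar>\<beta> j + h j\<bar> - \<bar>\<beta> j\<bar> + 2 * (if j \<in> S then \<bar>h j\<bar> else 0))"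
    by (intro sum_mono) (auto simp: S_def)
  also have "\<dots> = (\<Sum>j<p. \<bar>\<beta> j + h j\<bar>) - l1\<beta> + 2 * (\<Sum>j<p. if j \<in> S then \<bar>h j\<bar> else 0)"
    by (simp add: sum.distrib sum_subtractf l1\<beta>_def sum_distrib_left)
  also have "(\<Sum>j<p. if j \<in> S then \<bar>h j\<bar> else 0) = (\<Sum>j\<in>S. \<bar>h j\<bar>)"
    by (rule sum.mono_neutral_cong_right) (auto simp: S_def)
  finally show ?thesis using assms by (simp add: shifts_def \<delta>_def)
qed

lemma l1_support_le: "(\<Sum>j\<in>S. \<bar>h j\<bar>) \<le> sqrt (card S) * L2_set h {..<p}"
proof -
  have "(\<Sum>j\<in>S. \<bar>h j\<bar>) \<le> L2_set h S * L2_set (\<lambda>_. 1) S"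
    using L2_set_mult_ineq[of h "\<lambda>_. 1" S] by simp
  also have "\<dots> = sqrt (card S) * L2_set h S" by (simp add: L2_set_constant)
  also have "L2_set h S \<le> L2_set h {..<p}"
    unfolding L2_set_def by (intro real_sqrt_le_mono sum_mono2) (auto simp: S_def)
  finally show ?thesis by (simp add: mult_left_mono)
qed

lemma L2_coeff_le:
  assumes "L2_set (img h) {..<n} \<le> t"
  shows "L2_set h {..<p} \<le> t / sqrt (a * real n)"
  using order_trans[OF L2_ge assms] a n_pos by (simp add: pos_le_divide_eq mult.commute)

lemma l1_shift_le_radius:
  assumes "h \<in> shifts" "L2_set (img h) {..<n} \<le> t"
  shows "(\<Sum>j<p. \<bar>h j\<bar>) \<le> \<delta> + 2 * sqrt (card S) * (t / sqrt (a * real n))"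
proof -
  have "sqrt (card S) * L2_set h {..<p} \<le> sqrt (card S) * (t / sqrt (a * real n))"
    using L2_coeff_le[OF assms(2)] by (intro mult_left_mono) auto
  then show ?thesis using l1_shift_le_support[OF assms(1)] l1_support_le[of h] by simp
qed

text \<open>For \<open>\<delta> < 0\<close> the deficit has to be made up on the \<open>s\<close> coordinates of the support, where the \<open>l1\<close> and
  \<open>l2\<close> norms are comparable.\<close>

lemma t0_ge_of_negative_slack: "- \<delta> * sqrt (a * real n) \<le> sqrt (card S) * t0"
proof -
  obtain h where h: "h \<in> shifts" "h0 = img h" using h0_D by (auto simp: D_def)
  have "(\<Sum>j\<in>S. \<bar>h j\<bar>) \<le> (\<Sum>j<p. \<bar>h j\<bar>)" by (intro sum_mono2) (auto simp: S_def)
  then have "- \<delta> \<le> sqrt (card S) * L2_set h {..<p}"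
    using l1_shift_le_support[OF h(1)] l1_support_le[of h] by linarith
  also have "\<dots> \<le> sqrt (card S) * (t0 / sqrt (a * real n))"
    by (intro mult_left_mono L2_coeff_le) (simp_all add: t0_def flip: h(2))
  finally show ?thesis using a n_pos by (simp add: pos_le_divide_eq)
qed

lemma argmax_le_diameter: "argmax \<le> sqrt (b * real n) * (2 * L - \<delta>)"
  using argmax_le by (simp add: M_def \<delta>_def)

lemma t0_eq_0:
  assumes "0 \<le> \<delta>" shows "t0 = 0"
proof -
  have "(\<lambda>_. 0) \<in> shifts" using assms by (simp add: shifts_def \<delta>_def l1\<beta>_def)
  then have "img (\<lambda>_. 0) \<in> D" by (auto simp: D_def)
  from h0_min[OF this] show ?thesis
    using t0_nonneg by (simp add: t0_def img_def L2_set_0' antisym)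
qed

lemma width_0_nonneg:
  assumes "0 \<le> \<delta>" shows "0 \<le> width 0"
proof -
  have "(\<lambda>_. 0) \<in> shifts" using assms by (simp add: shifts_def \<delta>_def l1\<beta>_def)
  then have "img (\<lambda>_. 0) \<in> D" by (auto simp: D_def)
  moreover have img0: "img (\<lambda>_. 0) = (\<lambda>_. 0)" by (simp add: img_def fun_eq_iff)
  ultimately have "(\<lambda>_. 0) \<in> slice 0" by (simp add: slice_def L2_set_0')
  then have "(\<integral>z. 0 \<partial>std_gaussian n) \<le> width 0"
    using t0_eq_0[OF assms] by (intro width_ge[where h="\<lambda>_ _. 0"]) auto
  then show ?thesis by simp
qed

text \<open>For \<open>\<delta> \<ge> 0\<close> the point \<open>\<mu>\<close> lies in \<open>K\<close>, so the profile at its maximiser is at least its value at \<open>0\<close>.\<close>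

lemma argmax_sq_le_width:
  assumes "0 \<le> \<delta>" shows "argmax\<^sup>2 \<le> 2 * width argmax"
  using width_argmax[of 0] width_0_nonneg[OF assms] t0_eq_0[OF assms] by simp

lemma argmax_sq_le:
  assumes "0 \<le> \<delta>"
  shows "argmax\<^sup>2 \<le> 4 * L * sqrt (real n) * maxrate"
proof -
  have "width argmax \<le> sqrt (real n) * (2 * L) * maxrate"
  proof (rule width_le_l1[OF argmax_ge])
    fix h assume "h \<in> shifts"
    then show "(\<Sum>j<p. \<bar>h j\<bar>) \<le> 2 * L"
      using l1_shift_le[of h] assms by (simp add: \<delta>_def)
  qed (use L in simp)
  then show ?thesis using argmax_sq_le_width[OF assms] by (simp add: mult_ac)
qed

lemma argmax_le_of_zero_slack:
  assumes "\<delta> = 0"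
  shows "argmax \<le> 4 * sqrt (card S / a) * maxrate"
proof (cases "argmax = 0")
  case True
  then show ?thesis using a maxrate_pos by simp
next
  case False
  then have pos: "0 < argmax" using argmax_nonneg by simp
  have "width argmax \<le> sqrt (real n) * (2 * sqrt (card S) * (argmax / sqrt (a * real n))) * maxrate"
  proof (rule width_le_l1[OF argmax_ge])
    fix h assume "h \<in> shifts" "L2_set (img h) {..<n} \<le> argmax"
    from l1_shift_le_radius[OF this] assms
    show "(\<Sum>j<p. \<bar>h j\<bar>) \<le> 2 * sqrt (card S) * (argmax / sqrt (a * real n))" by simp
  qed (use argmax_nonneg a in simp)
  also have "\<dots> = argmax * (2 * sqrt (card S / a) * maxrate)"
    using n_pos a by (simp add: real_sqrt_mult real_sqrt_divide)
  finally have "argmax * argmax \<le> argmax * (4 * sqrt (card S / a) * maxrate)"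
    using argmax_sq_le_width assms by (simp add: power2_eq_square)
  then show ?thesis using pos by simp
qed

text \<open>Bound \<open>\<bar>g j\<bar>\<close> by \<open>u\<close> plus the excess \<open>e j\<close> over \<open>u\<close>. The first part is controlled by the \<open>l1\<close> norm of
  \<open>h\<close>, the second by Cauchy--Schwarz: the \<open>l2\<close> norm of \<open>h\<close> is small inside the ball, and the expected sum of the
  squared excesses is of order \<open>p * exp (- u\<^sup>2 / 2)\<close>.\<close>

lemma width_le_threshold:
  assumes \<delta>: "0 \<le> \<delta>" and t: "0 \<le> t" and u: "0 < u"
  shows "width t \<le> sqrt (real n) * (u * (\<delta> + 2 * sqrt (card S) * (t / sqrt (a * real n)))
      + t / sqrt (a * real n) * (2 * sqrt (real p) / u * exp (- (u\<^sup>2) / 4)))"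
proof -
  define \<tau> where "\<tau> = t / sqrt (a * real n)"
  define \<kappa> where "\<kappa> = 2 * sqrt (real p) / u * exp (- (u\<^sup>2) / 4)"
  \<comment> \<open>\<open>Y\<close> dominates the sum of squared excesses, by \<open>y\<^sup>2 / 2 \<le> exp y\<close> with \<open>y = u * (\<bar>g j\<bar> - u)\<close>;
    its mean is \<open>\<kappa>\<^sup>2\<close>\<close>
  define Y where "Y z = (\<Sum>j<p. exp (u * g j z) + exp (- u * g j z)) * (2 / u\<^sup>2 * exp (- (u\<^sup>2)))" for z
  have \<tau>: "0 \<le> \<tau>" using t a by (simp add: \<tau>_def)
  have \<kappa>: "0 < \<kappa>" using p u by (simp add: \<kappa>_def)
  have intY: "integrable (std_gaussian n) Y"
    unfolding Y_def[abs_def] by (intro integrable_mult_left integrable_exp_sum_g)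
  have "(\<integral>z. Y z \<partial>std_gaussian n) = 2 * real p * exp (u\<^sup>2 / 2) * (2 / u\<^sup>2 * exp (- (u\<^sup>2)))"
    unfolding Y_def by (simp only: integral_mult_left_zero integral_exp_sum_g)
  also have "\<dots> = 4 * real p / u\<^sup>2 * (exp (u\<^sup>2 / 2) * exp (- (u\<^sup>2)))" by simp
  also have "exp (u\<^sup>2 / 2) * exp (- (u\<^sup>2)) = (exp (- (u\<^sup>2) / 4))\<^sup>2"
    by (simp add: exp_add[symmetric] power2_eq_square[of "exp _"])
  finally have EY: "(\<integral>z. Y z \<partial>std_gaussian n) = \<kappa>\<^sup>2"
    by (simp add: \<kappa>_def power_mult_distrib power_divide)
  have "(\<Sum>i<n. z i * k i) \<le> sqrt (real n) * (u * (\<delta> + 2 * sqrt (card S) * \<tau>) + \<tau> * ((Y z / \<kappa> + \<kappa>) / 2))"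
    if k: "k \<in> slice t" for z k
  proof -
    have "k \<in> D" using k by (simp add: slice_def)
    then obtain h where h: "h \<in> shifts" "k = img h" by (auto simp: D_def)
    have ht: "L2_set (img h) {..<n} \<le> t" using k h by (simp add: slice_def)
    define e where "e j = max 0 (\<bar>g j z\<bar> - u)" for j
    have "(\<Sum>j<p. (e j)\<^sup>2) \<le> Y z"
      unfolding Y_def sum_distrib_right
    proof (rule sum_mono)
      fix j assume "j \<in> {..<p}"
      have "(e j)\<^sup>2 * (u\<^sup>2 / 2) \<le> exp (u * \<bar>g j z\<bar> - u\<^sup>2)"
      proof (cases "\<bar>g j z\<bar> \<le> u")
        case False
        then have "0 \<le> u * (\<bar>g j z\<bar> - u)" using u by simp
        from exp_lower_Taylor_quadratic[OF this] this
        have "(u * (\<bar>g j z\<bar> - u))\<^sup>2 / 2 \<le> exp (u * (\<bar>g j z\<bar> - u))" by simp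
        moreover have "(e j)\<^sup>2 * (u\<^sup>2 / 2) = (u * (\<bar>g j z\<bar> - u))\<^sup>2 / 2"
          using False by (simp add: e_def power_mult_distrib)
        moreover have "u * (\<bar>g j z\<bar> - u) = u * \<bar>g j z\<bar> - u\<^sup>2"
          by (simp add: power2_eq_square right_diff_distrib)
        ultimately show ?thesis by simp
      qed (simp add: e_def)
      also have "\<dots> = exp (u * \<bar>g j z\<bar>) * exp (- (u\<^sup>2))" by (simp add: exp_add[symmetric])
      also have "\<dots> \<le> (exp (u * g j z) + exp (- u * g j z)) * exp (- (u\<^sup>2))"
        by (intro mult_right_mono) (auto simp: abs_if add_increasing add_increasing2)
      finally show "(e j)\<^sup>2 \<le> (exp (u * g j z) + exp (- u * g j z)) * (2 / u\<^sup>2 * exp (- (u\<^sup>2)))"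
        using u by (simp add: pos_le_divide_eq)
    qed
    then have L2e: "L2_set e {..<p} \<le> sqrt (Y z)" by (simp add: L2_set_def)
    have Y0: "0 \<le> Y z" unfolding Y_def by (intro mult_nonneg_nonneg sum_nonneg) auto
    \<comment> \<open>the arithmetic-geometric mean inequality keeps the bound linear in \<open>Y\<close>, so that it can be integrated\<close>
    have "0 \<le> (sqrt (Y z) - \<kappa>)\<^sup>2" by simp
    then have "2 * sqrt (Y z) * \<kappa> \<le> Y z + \<kappa>\<^sup>2" using Y0 by (simp add: power2_diff)
    then have "sqrt (Y z) \<le> (Y z / \<kappa> + \<kappa>) / 2"
      using \<kappa> by (simp add: field_simps power2_eq_square)
    then have L2e': "L2_set e {..<p} \<le> (Y z / \<kappa> + \<kappa>) / 2" using L2e by linarith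
    have "(\<Sum>j<p. h j * g j z) \<le> (\<Sum>j<p. u * \<bar>h j\<bar> + \<bar>h j\<bar> * \<bar>e j\<bar>)"
    proof (rule sum_mono)
      fix j
      have "h j * g j z \<le> \<bar>h j\<bar> * \<bar>g j z\<bar>" by (simp add: abs_mult[symmetric])
      also have "\<dots> \<le> \<bar>h j\<bar> * (u + \<bar>e j\<bar>)" by (intro mult_left_mono) (auto simp: e_def)
      finally show "h j * g j z \<le> u * \<bar>h j\<bar> + \<bar>h j\<bar> * \<bar>e j\<bar>" by (simp add: algebra_simps)
    qed
    also have "\<dots> = u * (\<Sum>j<p. \<bar>h j\<bar>) + (\<Sum>j<p. \<bar>h j\<bar> * \<bar>e j\<bar>)"
      by (simp add: sum.distrib sum_distrib_left)
    also have "\<dots> \<le> u * (\<delta> + 2 * sqrt (card S) * \<tau>) + \<tau> * ((Y z / \<kappa> + \<kappa>) / 2)"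
    proof (intro add_mono mult_left_mono)
      show "(\<Sum>j<p. \<bar>h j\<bar>) \<le> \<delta> + 2 * sqrt (card S) * \<tau>"
        using l1_shift_le_radius[OF h(1) ht] by (simp add: \<tau>_def)
      have "(\<Sum>j<p. \<bar>h j\<bar> * \<bar>e j\<bar>) \<le> L2_set h {..<p} * L2_set e {..<p}" by (rule L2_set_mult_ineq)
      also have "\<dots> \<le> \<tau> * ((Y z / \<kappa> + \<kappa>) / 2)"
        using L2_coeff_le[OF ht] L2e' \<tau> by (intro mult_mono) (auto simp: \<tau>_def)
      finally show "(\<Sum>j<p. \<bar>h j\<bar> * \<bar>e j\<bar>) \<le> \<tau> * ((Y z / \<kappa> + \<kappa>) / 2)" .
    qed (use u in simp)
    finally show ?thesis unfolding h(2) inner_img by (intro mult_left_mono) auto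
  qed
  moreover have "t0 \<le> t" using t0_eq_0[OF \<delta>] t by simp
  ultimately have "width t \<le> (\<integral>z. sqrt (real n) * (u * (\<delta> + 2 * sqrt (card S) * \<tau>) + \<tau> * ((Y z / \<kappa> + \<kappa>) / 2)) \<partial>std_gaussian n)"
    by (intro width_le integrable_mult_right Bochner_Integration.integrable_add integrable_divide_zero intY
        finite_measure.integrable_const prob_space.finite_measure prob_space_std_gaussian)
  also have "\<dots> = sqrt (real n) * (u * (\<delta> + 2 * sqrt (card S) * \<tau>) + \<tau> * (((\<integral>z. Y z \<partial>std_gaussian n) / \<kappa> + \<kappa>) / 2))"
    using intY prob_space_std_gaussian[of n]
    by (simp add: finite_measure.integrable_const prob_space.finite_measure prob_space.prob_space)
  also have "((\<integral>z. Y z \<partial>std_gaussian n) / \<kappa> + \<kappa>) / 2 = \<kappa>"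
    unfolding EY using \<kappa> by (simp add: power2_eq_square)
  finally show ?thesis by (simp add: \<tau>_def \<kappa>_def)
qed

end

section \<open>A lower bound from exceedance counts\<close>

context lasso_design begin

definition corr :: "nat \<Rightarrow> nat \<Rightarrow> real" where
  "corr i j = (\<Sum>k<n. (x k i / sqrt (real n)) * (x k j / sqrt (real n)))"

text \<open>The \<open>i\<close>-th row \<open>w\<close> of the correlation matrix satisfies \<open>n * norm w ^ 2 = X\<^sub>i \<bullet> X w\<close> with the \<open>i\<close>-th
  column \<open>X\<^sub>i\<close>, which has norm \<open>sqrt n\<close>, and the norm of \<open>X w\<close> is at most \<open>sqrt (b * n) * norm w\<close>.\<close>

lemma sum_corr_sq_le:
  assumes "i < p"
  shows "(\<Sum>j<p. (corr i j)\<^sup>2) \<le> b"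
proof -
  define c where "c k = x k i / sqrt (real n)" for k
  define w where "w = L2_set (corr i) {..<p}"
  have w2: "w\<^sup>2 = (\<Sum>j<p. (corr i j)\<^sup>2)" by (simp add: w_def L2_set_def sum_nonneg)
  have c1: "L2_set c {..<n} = 1"
    using unit_column[OF assms] by (simp add: L2_set_def c_def)
  have "w\<^sup>2 = (\<Sum>j<p. \<Sum>k<n. corr i j * (c k * (x k j / sqrt (real n))))"
    unfolding w2 by (simp add: power2_eq_square corr_def[of i] c_def sum_distrib_left)
  also have "\<dots> = (\<Sum>k<n. \<Sum>j<p. corr i j * (c k * (x k j / sqrt (real n))))" by (rule sum.swap)
  also have "\<dots> = (\<Sum>k<n. c k * (img (corr i) k / sqrt (real n)))"
    by (simp add: img_def sum_distrib_left sum_divide_distrib mult_ac)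
  also have "\<dots> = (\<Sum>k<n. c k * img (corr i) k) / sqrt (real n)"
    by (simp add: sum_divide_distrib)
  also have "\<dots> \<le> (L2_set c {..<n} * L2_set (img (corr i)) {..<n}) / sqrt (real n)"
  proof (rule divide_right_mono)
    have "(\<Sum>k<n. c k * img (corr i) k) \<le> (\<Sum>k<n. \<bar>c k\<bar> * \<bar>img (corr i) k\<bar>)"
      by (intro sum_mono) (simp add: abs_mult[symmetric])
    also have "\<dots> \<le> L2_set c {..<n} * L2_set (img (corr i)) {..<n}" by (rule L2_set_mult_ineq)
    finally show "(\<Sum>k<n. c k * img (corr i) k) \<le> L2_set c {..<n} * L2_set (img (corr i)) {..<n}" .
  qed simp
  also have "\<dots> \<le> sqrt (b * real n) * w / sqrt (real n)"
    unfolding c1 w_def using L2_le[of "corr i"] by (intro divide_right_mono) auto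
  also have "\<dots> = sqrt b * w" using n_pos by (simp add: real_sqrt_mult)
  finally have "w * w \<le> sqrt b * w" by (simp add: power2_eq_square)
  moreover have "0 \<le> w" by (simp add: w_def)
  ultimately have "w \<le> sqrt b" using b_ge_a a by (cases "w = 0") auto
  then have "w\<^sup>2 \<le> (sqrt b)\<^sup>2" using \<open>0 \<le> w\<close> by (intro power_mono)
  then show ?thesis using w2 b_ge_a a by simp
qed

definition exceed :: "real \<Rightarrow> nat \<Rightarrow> (nat \<Rightarrow> real) \<Rightarrow> real" where
  "exceed u j z = indicator {u..} (g j z)"

definition count :: "real \<Rightarrow> (nat \<Rightarrow> real) \<Rightarrow> real" where
  "count u z = (\<Sum>j<p. exceed u j z)"

lemma measurable_g [measurable]: "g j \<in> borel_measurable (std_gaussian n)"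
  unfolding g_def[abs_def] by measurable

lemma integrable_exceed: "integrable (std_gaussian n) (exceed u j)"
proof -
  interpret prob_space "std_gaussian n" by (rule prob_space_std_gaussian)
  show ?thesis unfolding exceed_def[abs_def]
    by (rule integrable_const_bound[where B=1]) (auto simp: indicator_def)
qed

lemma integrable_exceed2: "integrable (std_gaussian n) (\<lambda>z. exceed u i z * exceed u j z)"
proof -
  interpret prob_space "std_gaussian n" by (rule prob_space_std_gaussian)
  show ?thesis unfolding exceed_def[abs_def]
    by (rule integrable_const_bound[where B=1]) (auto simp: indicator_def)
qed

lemma integral_exceed: "j < p \<Longrightarrow> (\<integral>z. exceed u j z \<partial>std_gaussian n) = gaussian_tail u"
  unfolding exceed_def g_def using prob_gaussian_functional_ge[OF unit_column] .

lemma integral_count: "(\<integral>z. count u z \<partial>std_gaussian n) = real p * gaussian_tail u"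
  unfolding count_def
  by (subst Bochner_Integration.integral_sum) (auto simp: integrable_exceed integral_exceed)

lemma count_sq: "(count u z)\<^sup>2 = (\<Sum>i<p. \<Sum>j<p. exceed u i z * exceed u j z)"
  by (simp add: count_def power2_eq_square sum_product)

text \<open>Pairs with correlation above \<open>\<eta>\<close> are bounded by a single tail probability and counted by
  Markov's inequality, through the factor \<open>corr\<^sup>2 / \<eta>\<^sup>2\<close>. For all other pairs the two exceedances are
  almost independent.\<close>

lemma integral_count_sq_le:
  assumes \<eta>: "0 < \<eta>" "\<eta> < 1" and u: "0 \<le> u" and R: "0 \<le> R" "\<eta> * R \<le> u"
  shows "(\<integral>z. (count u z)\<^sup>2 \<partial>std_gaussian n)
    \<le> real p * gaussian_tail u * b / \<eta>\<^sup>2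
      + (real p)\<^sup>2 * (gaussian_tail R + gaussian_tail u * gaussian_tail (u - \<eta> * R))"
proof -
  define q where "q = gaussian_tail u"
  define r where "r = gaussian_tail R + gaussian_tail u * gaussian_tail (u - \<eta> * R)"
  have q: "0 \<le> q" and r: "0 \<le> r" by (auto simp: q_def r_def)
  have pair: "(\<integral>z. exceed u i z * exceed u j z \<partial>std_gaussian n) \<le> q * ((corr i j)\<^sup>2 / \<eta>\<^sup>2) + r"
    if ij: "i < p" "j < p" for i j
  proof (cases "\<bar>corr i j\<bar> \<le> \<eta>")
    case True
    have "(\<integral>z. exceed u i z * exceed u j z \<partial>std_gaussian n) \<le> r"
      unfolding exceed_def g_def r_def
      by (rule prob_gaussian_pair_ge[OF unit_column[OF ij(1)] unit_column[OF ij(2)]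
            True[unfolded corr_def] \<eta>(2) u R])
    moreover have "0 \<le> q * ((corr i j)\<^sup>2 / \<eta>\<^sup>2)" using q by simp
    ultimately show ?thesis by linarith
  next
    case False
    then have "\<eta>\<^sup>2 \<le> (corr i j)\<^sup>2" using \<eta> by (simp add: abs_le_square_iff[symmetric])
    then have "1 \<le> (corr i j)\<^sup>2 / \<eta>\<^sup>2" using \<eta> by simp
    then have "q * 1 \<le> q * ((corr i j)\<^sup>2 / \<eta>\<^sup>2)" using q by (intro mult_left_mono)
    moreover have "(\<integral>z. exceed u i z * exceed u j z \<partial>std_gaussian n) \<le> (\<integral>z. exceed u i z \<partial>std_gaussian n)"
      by (intro integral_mono integrable_exceed2 integrable_exceed) (auto simp: exceed_def indicator_def)
    ultimately show ?thesis using integral_exceed[OF ij(1), of u] r by (simp add: q_def)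
  qed
  have "(\<integral>z. (count u z)\<^sup>2 \<partial>std_gaussian n) = (\<Sum>i<p. \<Sum>j<p. \<integral>z. exceed u i z * exceed u j z \<partial>std_gaussian n)"
    unfolding count_sq
    by (simp add: Bochner_Integration.integral_sum Bochner_Integration.integrable_sum integrable_exceed2)
  also have "\<dots> \<le> (\<Sum>i<p. \<Sum>j<p. q * ((corr i j)\<^sup>2 / \<eta>\<^sup>2) + r)"
    by (intro sum_mono pair) auto
  also have "\<dots> = (\<Sum>i<p. q / \<eta>\<^sup>2 * (\<Sum>j<p. (corr i j)\<^sup>2) + real p * r)"
    by (simp add: sum.distrib sum_distrib_left)
  also have "\<dots> \<le> (\<Sum>i<p. q / \<eta>\<^sup>2 * b + real p * r)"
    using q by (intro sum_mono add_mono mult_left_mono sum_corr_sq_le) auto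
  also have "\<dots> = real p * q * b / \<eta>\<^sup>2 + (real p)\<^sup>2 * r"
    by (simp add: power2_eq_square algebra_simps)
  finally show ?thesis by (simp add: q_def r_def)
qed

text \<open>The feasible vector \<open>h z\<close> spreads the slack \<open>\<delta>\<close> evenly over the coordinates where \<open>g j\<close> exceeds \<open>u\<close>.
  With \<open>m\<close> the expected number of exceedances, dividing by at least \<open>m / 2\<close> keeps the \<open>l2\<close> norm of \<open>h z\<close> below
  the radius for every \<open>z\<close>. The value attained is at least \<open>sqrt n * \<delta> * u\<close> times \<open>count / max count (m / 2)\<close>, which
  Chebyshev's inequality bounds from below in the mean; the bracket multiplied by \<open>4\<close> bounds the
  variance of the count relative to \<open>m\<^sup>2\<close>.\<close>

lemma width_ge_threshold:
  assumes \<delta>: "0 \<le> \<delta>" and t: "0 \<le> t" and u: "0 \<le> u" and \<eta>: "0 < \<eta>" "\<eta> < 1"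
    and R: "0 \<le> R" "\<eta> * R \<le> u" and q: "0 < gaussian_tail u"
    and radius: "2 * b * real n * \<delta>\<^sup>2 \<le> t\<^sup>2 * (real p * gaussian_tail u)"
  shows "sqrt (real n) * \<delta> * u * (1 - 4 * (b / (\<eta>\<^sup>2 * (real p * gaussian_tail u))
      + gaussian_tail R / (gaussian_tail u)\<^sup>2 + (gaussian_tail (u - \<eta> * R) / gaussian_tail u - 1))) \<le> width t"
proof -
  define m where "m = real p * gaussian_tail u"
  have m: "0 < m" using p q by (simp add: m_def)
  define c where "c z = max (count u z) (m / 2)" for z
  have c: "0 < c z" "m / 2 \<le> c z" "count u z \<le> c z" for z using m by (auto simp: c_def)
  define h where "h z j = \<delta> / c z * exceed u j z" for z j
  have ex: "0 \<le> exceed u j z" "(exceed u j z)\<^sup>2 = exceed u j z" for j z by (auto simp: exceed_def indicator_def)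
  have count: "0 \<le> count u z" for z by (simp add: count_def sum_nonneg ex)
  have h0: "0 \<le> h z j" for z j using \<delta> c[of z] ex by (simp add: h_def)
  have "(\<Sum>j<p. \<bar>\<beta> j + h z j\<bar>) \<le> L" for z
  proof -
    have "(\<Sum>j<p. \<bar>\<beta> j + h z j\<bar>) \<le> (\<Sum>j<p. \<bar>\<beta> j\<bar> + h z j)"
      using h0 by (intro sum_mono) (simp add: abs_triangle_ineq[THEN order_trans])
    also have "\<dots> = l1\<beta> + \<delta> / c z * count u z"
      by (simp add: sum.distrib l1\<beta>_def h_def count_def sum_distrib_left)
    also have "\<delta> / c z * count u z \<le> \<delta>"
      using c[of z] \<delta> by (simp add: pos_divide_le_eq mult_left_mono)
    finally show ?thesis by (simp add: \<delta>_def)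
  qed
  then have hs: "h z \<in> shifts" for z by (simp add: shifts_def)
  have "L2_set (img (h z)) {..<n} \<le> t" for z
  proof -
    have "(\<Sum>j<p. (h z j)\<^sup>2) = (\<delta> / c z)\<^sup>2 * count u z"
      unfolding count_def sum_distrib_left h_def power_mult_distrib ex(2) ..
    also have "\<dots> \<le> (\<delta> / c z)\<^sup>2 * c z" using c by (intro mult_left_mono) auto
    also have "\<dots> = \<delta>\<^sup>2 / c z" using c[of z] by (simp add: power_divide power2_eq_square)
    also have "\<dots> \<le> \<delta>\<^sup>2 / (m / 2)" using c[of z] m by (intro divide_left_mono) auto
    finally have "b * real n * (\<Sum>j<p. (h z j)\<^sup>2) \<le> b * real n * (\<delta>\<^sup>2 / (m / 2))"
      using b_ge_a a by (intro mult_left_mono) auto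
    also have "\<dots> \<le> t\<^sup>2" using radius m by (simp add: m_def[symmetric] field_simps)
    finally have "(\<Sum>i<n. (img (h z) i)\<^sup>2) \<le> t\<^sup>2"
      using norm_le[of "h z"] by (simp add: img_def)
    then show ?thesis unfolding L2_set_def using t by (intro real_le_lsqrt sum_nonneg) auto
  qed
  moreover have "img (h z) \<in> D" for z using hs by (auto simp: D_def)
  ultimately have slice: "img (h z) \<in> slice t" for z by (simp add: slice_def)
  define f where "f z = sqrt (real n) * \<delta> * u * (1 - 4 * ((count u z)\<^sup>2 - 2 * m * count u z + m\<^sup>2) / m\<^sup>2)" for z
  have f_le: "f z \<le> (\<Sum>i<n. z i * img (h z) i)" for z
  proof -
    \<comment> \<open>a pointwise form of Chebyshev's inequality: the left side is \<open>1 - 4 * (count - m)\<^sup>2 / m\<^sup>2\<close>\<close>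
    have "1 - 4 * ((count u z)\<^sup>2 - 2 * m * count u z + m\<^sup>2) / m\<^sup>2 \<le> count u z / c z"
    proof (cases "m / 2 \<le> count u z")
      case True
      then have "count u z / c z = 1" using m by (simp add: c_def max_def)
      moreover have "0 \<le> (count u z - m)\<^sup>2" by simp
      ultimately show ?thesis using m by (simp add: power2_diff algebra_simps)
    next
      case False
      then have "(m / 2)\<^sup>2 \<le> (m - count u z)\<^sup>2" using m by (intro power_mono) auto
      then have "m\<^sup>2 \<le> 4 * ((count u z)\<^sup>2 - 2 * m * count u z + m\<^sup>2)"
        by (simp add: power2_diff power_divide algebra_simps)
      then have "1 - 4 * ((count u z)\<^sup>2 - 2 * m * count u z + m\<^sup>2) / m\<^sup>2 \<le> 0"
        using m by (simp add: pos_le_divide_eq)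
      moreover have "0 \<le> count u z / c z" using count c(1)[of z] by simp
      ultimately show ?thesis by linarith
    qed
    then have "f z \<le> sqrt (real n) * \<delta> * u * (count u z / c z)"
      unfolding f_def using \<delta> u by (intro mult_left_mono) auto
    also have "\<dots> = sqrt (real n) * (\<Sum>j<p. h z j * u)"
      by (simp add: h_def count_def sum_distrib_left sum_divide_distrib mult_ac)
    also have "\<dots> \<le> sqrt (real n) * (\<Sum>j<p. h z j * g j z)"
    proof (rule mult_left_mono, rule sum_mono)
      fix j show "h z j * u \<le> h z j * g j z"
      proof (cases "u \<le> g j z")
        case True
        then show ?thesis by (intro mult_left_mono h0)
      next
        case False
        then show ?thesis by (simp add: h_def exceed_def)
      qed
    qed simp
    finally show ?thesis by (simp add: inner_img)
  qed
  interpret prob_space "std_gaussian n" by (rule prob_space_std_gaussian)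
  have int1: "integrable (std_gaussian n) (count u)"
    unfolding count_def[abs_def] by (intro Bochner_Integration.integrable_sum integrable_exceed)
  have int2: "integrable (std_gaussian n) (\<lambda>z. (count u z)\<^sup>2)"
    unfolding count_sq by (intro Bochner_Integration.integrable_sum integrable_exceed2)
  have intf: "integrable (std_gaussian n) f"
    unfolding f_def[abs_def] using int1 int2 by auto
  define E2 where "E2 = (\<integral>z. (count u z)\<^sup>2 \<partial>std_gaussian n)"
  have "(\<integral>z. f z \<partial>std_gaussian n) = sqrt (real n) * \<delta> * u * (1 - 4 * (E2 - 2 * m * m + m\<^sup>2) / m\<^sup>2)"
    unfolding f_def using int1 int2 by (simp add: prob_space integral_count E2_def m_def[symmetric])
  also have "\<dots> = sqrt (real n) * \<delta> * u * (1 - 4 * (E2 / m\<^sup>2 - 1))"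
    using m by (simp add: power2_eq_square diff_divide_distrib)
  finally have Ef: "(\<integral>z. f z \<partial>std_gaussian n) = sqrt (real n) * \<delta> * u * (1 - 4 * (E2 / m\<^sup>2 - 1))" .
  have "E2 / m\<^sup>2 \<le> (m * b / \<eta>\<^sup>2 + (real p)\<^sup>2 * (gaussian_tail R + gaussian_tail u * gaussian_tail (u - \<eta> * R))) / m\<^sup>2"
    using integral_count_sq_le[OF \<eta> u R] by (intro divide_right_mono) (auto simp: E2_def m_def)
  also have "\<dots> = b / (\<eta>\<^sup>2 * m) + gaussian_tail R / (gaussian_tail u)\<^sup>2 + gaussian_tail (u - \<eta> * R) / gaussian_tail u"
    using \<eta> q p by (simp add: m_def add_divide_distrib distrib_left power_mult_distrib power2_eq_square)
  finally have E2: "E2 / m\<^sup>2 - 1 \<le> b / (\<eta>\<^sup>2 * m) + gaussian_tail R / (gaussian_tail u)\<^sup>2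
      + (gaussian_tail (u - \<eta> * R) / gaussian_tail u - 1)" by simp
  have "sqrt (real n) * \<delta> * u * (1 - 4 * (b / (\<eta>\<^sup>2 * m) + gaussian_tail R / (gaussian_tail u)\<^sup>2
      + (gaussian_tail (u - \<eta> * R) / gaussian_tail u - 1))) \<le> (\<integral>z. f z \<partial>std_gaussian n)"
    unfolding Ef using E2 \<delta> u by (intro mult_left_mono) auto
  also have "\<dots> \<le> width t"
    using t0_eq_0[OF \<delta>] t by (intro width_ge[where h="\<lambda>z. img (h z)"] intf f_le slice) auto
  finally show ?thesis by (simp add: m_def)
qed

end

section \<open>Thresholds at the critical radius\<close>

text \<open>With \<open>N\<close> the number of rows of the design, the conditions under which the two
  thresholds \<open>c1 * sqrt (ln N)\<close> and \<open>c2 * sqrt (ln N)\<close> separate the two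
  radii. In the last one the difference of the main terms, \<open>d * (c2 - c1) * sqrt (ln N)\<close>, tends to
  infinity while all the other terms stay bounded.\<close>

lemma interior_asymptotics:
  fixes a b r d \<epsilon> c1 c2 s :: real
  assumes "0 < a" "0 < b" "0 < r" "0 < d" "0 < \<epsilon>" "0 \<le> s" "0 < c1" "c1 < c2"
  shows "eventually (\<lambda>N. c2 * sqrt (ln N) + 1 / 2 + ln (sqrt (2 * pi)) \<le> \<epsilon> / 4 * ln N) at_top"
    and "eventually (\<lambda>N. 2 * b * d\<^sup>2 / r \<le> N powr (\<epsilon> / 4)) at_top"
    and "eventually (\<lambda>N. N powr (-1/8) * (2 * sqrt (ln N)) \<le> c2 * sqrt (ln N)) at_top"
    and "eventually (\<lambda>N. N powr (-1/8) * (2 * sqrt (ln N)) * (c2 * sqrt (ln N)) \<le> 1) at_top"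
    and "eventually (\<lambda>N :: real. N powr (-1/8) < 1) at_top"
    and "eventually (\<lambda>N. c1 * sqrt (ln N) * (d + 2 * sqrt s * (N powr (-1/4) / sqrt a))
        + 2 * sqrt (r / a) / (c1 * sqrt (ln N))
      < d * (c2 * sqrt (ln N)) * (1 - 4 * (b / r * N powr (-1/4) + N powr (-1)
        + 2 * exp 1 * sqrt (ln N) * N powr (-1/16))) - 1 / 2) at_top"
proof -
  show "eventually (\<lambda>N. c2 * sqrt (ln N) + 1 / 2 + ln (sqrt (2 * pi)) \<le> \<epsilon> / 4 * ln N) at_top"
    using assms by real_asymp
  show "eventually (\<lambda>N. 2 * b * d\<^sup>2 / r \<le> N powr (\<epsilon> / 4)) at_top"
    using assms by real_asymp
  show "eventually (\<lambda>N. N powr (-1/8) * (2 * sqrt (ln N)) \<le> c2 * sqrt (ln N)) at_top"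
    using assms by real_asymp
  show "eventually (\<lambda>N. N powr (-1/8) * (2 * sqrt (ln N)) * (c2 * sqrt (ln N)) \<le> 1) at_top"
    using assms by real_asymp
  show "eventually (\<lambda>N :: real. N powr (-1/8) < 1) at_top"
    by real_asymp
  define K1 where "K1 = c1 * 2 * sqrt s / sqrt a"
  define K2 where "K2 = 2 * sqrt (r / a) / c1"
  define K3 where "K3 = 4 * d * c2"
  define e where "e N = K1 * (sqrt (ln N) * N powr (-1/4)) + K2 * (1 / sqrt (ln N))
     + K3 * (b / r * (sqrt (ln N) * N powr (-1/4)) + sqrt (ln N) * N powr (-1)
        + 2 * exp 1 * (ln N * N powr (-1/16)))" for N :: real
  have l1: "((\<lambda>N :: real. sqrt (ln N) * N powr (-1/4)) \<longlongrightarrow> 0) at_top" by real_asymp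
  have l2: "((\<lambda>N :: real. 1 / sqrt (ln N)) \<longlongrightarrow> 0) at_top" by real_asymp
  have l3: "((\<lambda>N :: real. sqrt (ln N) * N powr (-1)) \<longlongrightarrow> 0) at_top" by real_asymp
  have l4: "((\<lambda>N :: real. ln N * N powr (-1/16)) \<longlongrightarrow> 0) at_top" by real_asymp
  have "(e \<longlongrightarrow> K1 * 0 + K2 * 0 + K3 * (b / r * 0 + 0 + 2 * exp 1 * 0)) at_top"
    unfolding e_def by (intro tendsto_intros l1 l2 l3 l4)
  then have e1: "eventually (\<lambda>N. e N < 1) at_top"
    by (auto simp: order_tendsto_iff)
  have "filterlim (\<lambda>N. (d * (c2 - c1)) * sqrt (ln N)) at_top at_top"
    using assms by real_asymp
  then have e2: "eventually (\<lambda>N. 2 \<le> (d * (c2 - c1)) * sqrt (ln N)) at_top"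
    by (simp add: filterlim_at_top)
  show "eventually (\<lambda>N. c1 * sqrt (ln N) * (d + 2 * sqrt s * (N powr (-1/4) / sqrt a))
        + 2 * sqrt (r / a) / (c1 * sqrt (ln N))
      < d * (c2 * sqrt (ln N)) * (1 - 4 * (b / r * N powr (-1/4) + N powr (-1)
        + 2 * exp 1 * sqrt (ln N) * N powr (-1/16))) - 1 / 2) at_top"
    using e1 e2 eventually_gt_at_top[of 1]
  proof eventually_elim
    case (elim N)
    have "sqrt (ln N) * sqrt (ln N) = ln N" using elim by simp
    then have "e N = c1 * sqrt (ln N) * (2 * sqrt s * (N powr (-1/4) / sqrt a))
        + 2 * sqrt (r / a) / (c1 * sqrt (ln N))
        + d * (c2 * sqrt (ln N)) * (4 * (b / r * N powr (-1/4) + N powr (-1)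
        + 2 * exp 1 * sqrt (ln N) * N powr (-1/16)))"
      unfolding e_def K1_def K2_def K3_def by (simp add: algebra_simps)
    then show ?case using elim by (simp add: algebra_simps)
  qed
qed

lemma upper_asymptotics:
  fixes L r \<epsilon> :: real
  assumes "0 < L" "0 < r" "0 < \<epsilon>"
  shows "eventually (\<lambda>N. 4 * L * sqrt N * sqrt (2 * ln (2 * (r * N))) \<le> N powr (1/2 + 2 * \<epsilon>)) at_top"
  using assms by real_asymp

context lasso_design begin

text \<open>The thresholds match the radii \<open>t1 = n powr (1/4 - \<epsilon>)\<close> and \<open>t2 = n powr (1/4 - \<epsilon> / 2)\<close>. The
  exponent of \<open>u1\<close> makes the Cauchy--Schwarz term at \<open>t1\<close> bounded. At level \<open>u2\<close> the expected number of
  exceedances is at least of order \<open>n powr (1/2 + 5/4 * \<epsilon>)\<close>, more than the order \<open>n powr (1/2 + \<epsilon>)\<close> that the radius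
  \<open>t2\<close> demands; the spare \<open>\<epsilon> / 4\<close> absorbs all constants.\<close>

lemma argmax_ge_powr:
  assumes r: "real p = r * real n" and \<delta>: "0 < \<delta>" and \<epsilon>: "0 < \<epsilon>" "\<epsilon> \<le> 1/8"
    and c1: "c1 = sqrt (1 - 4 * \<epsilon>)" and c2: "c2 = sqrt (1 - 3 * \<epsilon>)"
    and 1: "c2 * sqrt (ln (real n)) + 1 / 2 + ln (sqrt (2 * pi)) \<le> \<epsilon> / 4 * ln (real n)"
    and 2: "2 * b * \<delta>\<^sup>2 / r \<le> real n powr (\<epsilon> / 4)"
    and 3: "real n powr (-1/8) * (2 * sqrt (ln (real n))) \<le> c2 * sqrt (ln (real n))"
    and 4: "real n powr (-1/8) * (2 * sqrt (ln (real n))) * (c2 * sqrt (ln (real n))) \<le> 1"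
    and 5: "real n powr (-1/8) < 1"
    and 6: "c1 * sqrt (ln (real n)) * (\<delta> + 2 * sqrt (card S) * (real n powr (-1/4) / sqrt a))
        + 2 * sqrt (r / a) / (c1 * sqrt (ln (real n)))
      < \<delta> * (c2 * sqrt (ln (real n))) * (1 - 4 * (b / r * real n powr (-1/4) + real n powr (-1)
        + 2 * exp 1 * sqrt (ln (real n)) * real n powr (-1/16))) - 1 / 2"
  shows "real n powr (1/4 - \<epsilon>) \<le> argmax"
proof (rule ccontr)
  assume contra: "\<not> real n powr (1/4 - \<epsilon>) \<le> argmax"
  define N where "N = real n"
  note 1 = 1[folded N_def] and 2 = 2[folded N_def] and 3 = 3[folded N_def]
    and 4 = 4[folded N_def] and 5 = 5[folded N_def] and 6 = 6[folded N_def] and r = r[folded N_def]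
  have N: "2 \<le> N" using n by (simp add: N_def)
  have N0: "0 < N" using N by simp
  have "0 < r * N" using r p by simp
  then have rpos: "0 < r" using N0 by (simp add: zero_less_mult_iff)
  have b: "0 < b" using a b_ge_a by simp
  define l where "l = ln N"
  have l: "0 < l" using N by (simp add: l_def)
  have powr: "N powr e = exp (e * l)" for e using N0 by (simp add: powr_def l_def)
  have powr_mono: "N powr e \<le> N powr e'" if "e \<le> e'" for e e' using that N by (intro powr_mono) auto
  define u1 where "u1 = c1 * sqrt (ln N)"
  define u2 where "u2 = c2 * sqrt (ln N)"
  have u1: "0 < u1" "u1\<^sup>2 = (1 - 4 * \<epsilon>) * l"
    using \<epsilon> l by (auto simp: u1_def c1 power_mult_distrib l_def)
  have u2: "0 < u2" "u2\<^sup>2 = (1 - 3 * \<epsilon>) * l"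
    using \<epsilon> l by (auto simp: u2_def c2 power_mult_distrib l_def)
  define t1 where "t1 = N powr (1/4 - \<epsilon>)"
  define t2 where "t2 = N powr (1/4 - \<epsilon> / 2)"
  define \<eta> where "\<eta> = N powr (-1/8)"
  define R where "R = 2 * sqrt (ln N)"
  define q where "q = gaussian_tail u2"
  have t: "0 \<le> t1" "0 \<le> t2" by (auto simp: t1_def t2_def)
  have sqN: "sqrt N = N powr (1/2)" using N0 by (simp add: powr_half_sqrt)
  have ratio: "t1 / sqrt (a * N) = N powr (-1/4 - \<epsilon>) / sqrt a"
  proof -
    have "t1 / sqrt (a * N) = N powr (1/4 - \<epsilon>) / N powr (1/2) / sqrt a"
      by (simp add: t1_def real_sqrt_mult sqN)
    also have "N powr (1/4 - \<epsilon>) / N powr (1/2) = N powr (1/4 - \<epsilon> - 1/2)"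
      by (simp only: powr_diff)
    also have "1/4 - \<epsilon> - 1/2 = -1/4 - \<epsilon>" by simp
    finally show ?thesis .
  qed
  have "t1 / sqrt (a * N) \<le> N powr (-1/4) / sqrt a"
    unfolding ratio using \<epsilon> a by (intro divide_right_mono powr_mono) auto
  then have ub1: "u1 * (\<delta> + 2 * sqrt (card S) * (t1 / sqrt (a * N))) \<le> u1 * (\<delta> + 2 * sqrt (card S) * (N powr (-1/4) / sqrt a))"
    using u1 by (intro mult_left_mono add_left_mono) auto
  have "exp (- (u1\<^sup>2) / 4) = N powr (\<epsilon> - 1/4)"
    unfolding u1 powr by (simp add: field_simps)
  then have "t1 / sqrt (a * N) * (2 * sqrt (real p) / u1 * exp (- (u1\<^sup>2) / 4))
      = (N powr (-1/4 - \<epsilon>) * N powr (1/2) * N powr (\<epsilon> - 1/4)) * (2 * sqrt (r / a) / u1)"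
    unfolding ratio r by (simp add: real_sqrt_mult sqN real_sqrt_divide)
  also have "N powr (-1/4 - \<epsilon>) * N powr (1/2) * N powr (\<epsilon> - 1/4) = 1"
    using N0 by (simp add: powr_add[symmetric])
  finally have ub2: "t1 / sqrt (a * N) * (2 * sqrt (real p) / u1 * exp (- (u1\<^sup>2) / 4)) = 2 * sqrt (r / a) / u1"
    by simp
  have "width t1 \<le> sqrt N * (u1 * (\<delta> + 2 * sqrt (card S) * (t1 / sqrt (a * N)))
      + t1 / sqrt (a * N) * (2 * sqrt (real p) / u1 * exp (- (u1\<^sup>2) / 4)))"
    unfolding N_def by (rule width_le_threshold) (use \<delta> t u1 in auto)
  also have "\<dots> \<le> sqrt N * (u1 * (\<delta> + 2 * sqrt (card S) * (N powr (-1/4) / sqrt a)) + 2 * sqrt (r / a) / u1)"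
    unfolding ub2
  proof (rule mult_left_mono)
    show "u1 * (\<delta> + 2 * sqrt (card S) * (t1 / sqrt (a * N))) + 2 * sqrt (r / a) / u1
        \<le> u1 * (\<delta> + 2 * sqrt (card S) * (N powr (-1/4) / sqrt a)) + 2 * sqrt (r / a) / u1"
      using ub1 by linarith
  qed (use N0 in simp)
  finally have upper: "width t1 \<le> sqrt N * (u1 * (\<delta> + 2 * sqrt (card S) * (N powr (-1/4) / sqrt a)) + 2 * sqrt (r / a) / u1)" .
  \<comment> \<open>\<open>u2\<^sup>2 / 2\<close> contributes the exponent \<open>-1/2 + 3/2 * \<epsilon>\<close>; the rest of \<open>(u2 + 1)\<^sup>2 / 2\<close> and
    the normalising constant cost at most \<open>\<epsilon> / 4\<close>\<close>
  have "N powr (-1/2 + 5/4 * \<epsilon>) \<le> std_normal_density (u2 + 1)"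
  proof -
    have "(-1/2 + 5/4 * \<epsilon>) * l \<le> - ((u2 + 1)\<^sup>2) / 2 - ln (sqrt (2 * pi))"
    proof -
      have "u2 + 1 / 2 + ln (sqrt (2 * pi)) \<le> \<epsilon> / 4 * l" using 1 by (simp only: u2_def l_def)
      moreover have "(u2 + 1)\<^sup>2 = l - 3 * (\<epsilon> * l) + 2 * u2 + 1"
        using u2(2) by (simp add: power2_sum algebra_simps)
      moreover have "(-1/2 + 5/4 * \<epsilon>) * l = - l / 2 + 5/4 * (\<epsilon> * l)" by (simp add: algebra_simps)
      ultimately show ?thesis by linarith
    qed
    then have "exp ((-1/2 + 5/4 * \<epsilon>) * l) \<le> exp (- ((u2 + 1)\<^sup>2) / 2 - ln (sqrt (2 * pi)))"
      by simp
    also have "\<dots> = std_normal_density (u2 + 1)"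
      by (simp add: exp_diff std_normal_density_def)
    finally show ?thesis by (simp add: powr)
  qed
  then have q_ge: "N powr (-1/2 + 5/4 * \<epsilon>) \<le> q"
    using gaussian_tail_ge[of u2] u2(1) by (simp add: q_def)
  moreover have "0 < N powr (-1/2 + 5/4 * \<epsilon>)" using N0 by simp
  ultimately have q: "0 < q" by linarith
  have \<eta>: "0 < \<eta>" "\<eta> < 1" using 5 N0 by (auto simp: \<eta>_def)
  have R: "0 \<le> R" "\<eta> * R \<le> u2" using 3 N by (auto simp: R_def \<eta>_def u2_def)
  have "2 * b * \<delta>\<^sup>2 \<le> r * N powr (\<epsilon> / 4)" using 2 rpos by (simp add: pos_divide_le_eq mult.commute)
  then have "2 * b * N * \<delta>\<^sup>2 \<le> N * (r * N powr (\<epsilon> / 4))" using N0 by (simp add: mult_ac)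
  also have "\<dots> = t2\<^sup>2 * (r * N * N powr (-1/2 + 5/4 * \<epsilon>))"
    by (simp add: t2_def power2_eq_square powr_add[symmetric] mult_ac) 
  also have "\<dots> \<le> t2\<^sup>2 * (real p * q)"
    unfolding r using q_ge rpos N0 by (intro mult_left_mono) auto
  finally have radius: "2 * b * real n * \<delta>\<^sup>2 \<le> t2\<^sup>2 * (real p * gaussian_tail u2)"
    by (simp add: N_def q_def)
  have lower0: "sqrt N * \<delta> * u2 * (1 - 4 * (b / (\<eta>\<^sup>2 * (real p * q)) + gaussian_tail R / q\<^sup>2
      + (gaussian_tail (u2 - \<eta> * R) / q - 1))) \<le> width t2"
    unfolding N_def q_def by (rule width_ge_threshold) (use \<delta> t u2 \<eta> R q radius in \<open>auto simp: q_def\<close>)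
  \<comment> \<open>the three contributions to the relative variance: strongly correlated pairs, excessive
    values beyond \<open>R\<close>, and the shift of the threshold by \<open>\<eta> * R\<close>\<close>
  have v1: "b / (\<eta>\<^sup>2 * (real p * q)) \<le> b / r * N powr (-1/4)"
  proof -
    have "N powr (1/4) \<le> N powr (-1/4) * (N * N powr (-1/2 + 5/4 * \<epsilon>))"
    proof -
      have "N powr (1/4) \<le> N powr (-1/4 + (1 + (-1/2 + 5/4 * \<epsilon>)))" using \<epsilon> by (intro powr_mono) auto
      then show ?thesis using N0 by (simp only: powr_add powr_one)
    qed
    also have "\<dots> \<le> \<eta>\<^sup>2 * (N * q)"
      using q_ge N0 by (intro mult_mono) (auto simp: \<eta>_def power2_eq_square powr_add[symmetric])
    finally have *: "r * N powr (1/4) \<le> \<eta>\<^sup>2 * (real p * q)"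
      unfolding r using rpos by (simp add: mult_ac)
    have "b / (\<eta>\<^sup>2 * (real p * q)) \<le> b / (r * N powr (1/4))"
      using * b rpos N0 \<eta> q p by (intro divide_left_mono mult_pos_pos) auto
    also have "\<dots> = b / r * N powr (-1/4)" by (simp add: powr_minus_divide)
    finally show ?thesis .
  qed
  have v2: "gaussian_tail R / q\<^sup>2 \<le> N powr (-1)"
  proof -
    have "gaussian_tail R \<le> exp (- (R\<^sup>2) / 2)" by (rule gaussian_tail_le[OF R(1)])
    also have "\<dots> = N powr (-2)" using l by (simp add: powr R_def power_mult_distrib l_def)
    also have "\<dots> \<le> N powr (-1 + (-1/2 + 5/4 * \<epsilon>) + (-1/2 + 5/4 * \<epsilon>))" using \<epsilon> by (intro powr_mono) auto
    also have "\<dots> = N powr (-1) * (N powr (-1/2 + 5/4 * \<epsilon>))\<^sup>2"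
      by (simp only: powr_add power2_eq_square mult.assoc)
    also have "\<dots> \<le> N powr (-1) * q\<^sup>2" using q_ge by (intro mult_left_mono power_mono) auto
    finally show ?thesis using q by (simp add: pos_divide_le_eq)
  qed
  have v3: "gaussian_tail (u2 - \<eta> * R) / q - 1 \<le> 2 * exp 1 * sqrt (ln N) * N powr (-1/16)"
  proof -
    define e where "e = \<eta> * R"
    have e: "0 \<le> e" "e \<le> u2" "e * u2 \<le> 1" using R \<eta> 4 by (auto simp: e_def \<eta>_def R_def u2_def)
    have "sqrt (2 * pi) \<ge> 1" using pi_ge_two by (intro real_le_rsqrt) auto
    then have "std_normal_density (u2 - e) \<le> exp (- ((u2 - e)\<^sup>2) / 2)"
      by (simp add: std_normal_density_def divide_le_eq mult_left_le)
    also have "\<dots> \<le> exp (1 - u2\<^sup>2 / 2)"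
    proof -
      have "(u2 - e)\<^sup>2 = u2\<^sup>2 - 2 * (e * u2) + e\<^sup>2" by (simp add: power2_diff algebra_simps)
      then have "- ((u2 - e)\<^sup>2) / 2 \<le> 1 - u2\<^sup>2 / 2" using e(3) zero_le_power2[of e] by argo
      then show ?thesis by simp
    qed
    also have "\<dots> = exp 1 * N powr (-1/2 + 3/2 * \<epsilon>)"
      unfolding u2(2) powr by (simp add: exp_add[symmetric] field_simps)
    finally have dens: "std_normal_density (u2 - e) \<le> exp 1 * N powr (-1/2 + 3/2 * \<epsilon>)" .
    have "gaussian_tail (u2 - e) - q \<le> e * std_normal_density (u2 - e)"
      using gaussian_tail_shift_le[OF e(1,2)] by (simp add: q_def)
    also have "\<dots> \<le> e * (exp 1 * N powr (-1/2 + 3/2 * \<epsilon>))" using e dens by (intro mult_left_mono)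
    also have "\<dots> = 2 * exp 1 * sqrt (ln N) * (N powr (-1/8) * N powr (-1/2 + 3/2 * \<epsilon>))"
      by (simp add: e_def \<eta>_def R_def mult_ac)
    also have "N powr (-1/8) * N powr (-1/2 + 3/2 * \<epsilon>) \<le> N powr (-1/16) * N powr (-1/2 + 5/4 * \<epsilon>)"
      unfolding powr_add[symmetric] using \<epsilon> by (intro powr_mono) auto
    also have "N powr (-1/16) * N powr (-1/2 + 5/4 * \<epsilon>) \<le> N powr (-1/16) * q"
      using q_ge by (intro mult_left_mono) auto
    finally have "gaussian_tail (u2 - e) - q \<le> 2 * exp 1 * sqrt (ln N) * (N powr (-1/16) * q)"
      using N by (simp add: mult_left_mono)
    then have "(gaussian_tail (u2 - e) - q) / q \<le> 2 * exp 1 * sqrt (ln N) * N powr (-1/16)"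
      using q by (simp add: pos_divide_le_eq mult_ac)
    then show ?thesis using q by (simp add: e_def diff_divide_distrib)
  qed
  let ?V = "b / r * N powr (-1/4) + N powr (-1) + 2 * exp 1 * sqrt (ln N) * N powr (-1/16)"
  have "sqrt N * \<delta> * u2 * (1 - 4 * ?V) \<le> sqrt N * \<delta> * u2 * (1 - 4 * (b / (\<eta>\<^sup>2 * (real p * q)) + gaussian_tail R / q\<^sup>2
      + (gaussian_tail (u2 - \<eta> * R) / q - 1)))"
    using v1 v2 v3 N0 \<delta> u2(1) by (intro mult_left_mono) auto
  then have lower: "sqrt N * (\<delta> * u2 * (1 - 4 * ?V)) \<le> width t2" using lower0 by (simp add: mult.assoc)
  have "t2\<^sup>2 = N powr (1/2 - \<epsilon>)" by (simp add: t2_def power2_eq_square powr_add[symmetric])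
  also have "\<dots> \<le> sqrt N" unfolding sqN using \<epsilon> by (intro powr_mono) auto
  finally have t2: "t2\<^sup>2 \<le> sqrt N" .
  have "sqrt N * (u1 * (\<delta> + 2 * sqrt (card S) * (N powr (-1/4) / sqrt a)) + 2 * sqrt (r / a) / u1)
      < sqrt N * (\<delta> * u2 * (1 - 4 * ?V) - 1 / 2)"
    using 6 N0 unfolding u1_def u2_def by (intro mult_strict_left_mono) auto
  then have "width t1 < width t2 - sqrt N / 2" using upper lower by (simp add: right_diff_distrib)
  also have "\<dots> \<le> width t2 - t2\<^sup>2 / 2" using t2 by simp
  also have "\<dots> \<le> width argmax - argmax\<^sup>2 / 2"
    using t0_eq_0[of] \<delta> t by (intro width_argmax) simp
  also have "\<dots> \<le> width argmax" by simp
  also have "\<dots> \<le> width t1"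
    using contra by (intro width_mono argmax_ge) (simp add: t1_def N_def)
  finally show False by simp
qed

end

section \<open>From matrices to the theorem\<close>

lemma lasso_design_of_setup:
  assumes "lasso_setup n p X \<beta> L a b s \<delta> r"
  shows "lasso_design n p (\<lambda>i j. X $$ (i, j)) a b L"
proof
  have X: "X \<in> carrier_mat n p" and n: "2 \<le> n" and p: "1 \<le> p"
    and e: "smallest_eigenvalue (gram X) a" "largest_eigenvalue (gram X) b"
    and one: "\<forall>i<p. gram X $$ (i, i) = 1"
    using assms by (auto simp: lasso_setup_def)
  show "2 \<le> n" "1 \<le> p" "0 < a" "0 < L" using assms by (auto simp: lasso_setup_def)
  show "a * real n * (\<Sum>j<p. (h j)\<^sup>2) \<le> (\<Sum>i<n. (\<Sum>j<p. X $$ (i, j) * h j)\<^sup>2)" for h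
    by (rule design_norm_ge[OF X _ _ e]) (use n p in auto)
  show "(\<Sum>i<n. (\<Sum>j<p. X $$ (i, j) * h j)\<^sup>2) \<le> b * real n * (\<Sum>j<p. (h j)\<^sup>2)" for h
    by (rule design_norm_le[OF X _ _ e]) (use n p in auto)
  show "(\<Sum>i<n. (X $$ (i, j))\<^sup>2) = real n" if "j < p" for j
    using one[rule_format, OF that] gram_entry[OF X that that] n by (simp add: power2_eq_square)
qed

context
  fixes n p :: nat and X :: "real Matrix.mat" and \<beta> :: "real Matrix.vec" and L a b \<delta> r :: real and s :: nat
  assumes lasso: "lasso_setup n p X \<beta> L a b s \<delta> r"
begin

interpretation lasso_design n p "\<lambda>i j. X $$ (i, j)" a b L "\<lambda>j. \<beta> $ j"
  rewrites "lasso_design.\<delta> p L (\<lambda>j. \<beta> $ j) = \<delta>"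
    and "card (lasso_design.S p (\<lambda>j. \<beta> $ j)) = s"
proof -
  show I: "lasso_design n p (\<lambda>i j. X $$ (i, j)) a b L"
    by (rule lasso_design_of_setup[OF lasso])
  interpret I: lasso_design n p "\<lambda>i j. X $$ (i, j)" a b L "\<lambda>j. \<beta> $ j" by (rule I)
  show "I.\<delta> = \<delta>" "card I.S = s"
    using lasso by (auto simp: I.\<delta>_def I.l1\<beta>_def I.S_def lasso_setup_def l1_norm_def)
qed

lemma setup_p: "real p = r * real n"
  using lasso by (simp add: lasso_setup_def)

lemma setup_ranges: "0 < r" "0 < a" "0 < b" "0 < L" "2 \<le> n" "1 \<le> p"
  using lasso b_ge_a a L n p by (auto simp: lasso_setup_def)

text \<open>The two suprema range over the same set of real numbers, by the substitution \<open>h = \<gamma> - \<beta>\<close>.\<close>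

lemma t_opt_eq_argmax:
  "t_opt n (l1_image X L) (X *\<^sub>v \<beta>) = argmax"
proof -
  have X: "dim_row X = n" "dim_col X = p" and \<beta>: "dim_vec \<beta> = p"
    using lasso by (auto simp: lasso_setup_def)
  let ?K = "\<lambda>t. {\<nu> \<in> l1_image X L. l2_norm (\<nu> - X *\<^sub>v \<beta>) \<le> t}"
  have index: "(X *\<^sub>v \<gamma> - X *\<^sub>v \<beta>) $ i = img (\<lambda>j. \<gamma> $ j - \<beta> $ j) i"
    if "\<gamma> \<in> carrier_vec p" "i < n" for \<gamma> i
    using that X \<beta> by (simp add: img_def scalar_prod_def atLeast0LessThan right_diff_distrib sum_subtractf)
  have l2: "l2_norm (X *\<^sub>v \<gamma> - X *\<^sub>v \<beta>) = L2_set (img (\<lambda>j. \<gamma> $ j - \<beta> $ j)) {..<n}"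
    if "\<gamma> \<in> carrier_vec p" for \<gamma>
    using index[OF that] X by (simp add: l2_norm_def L2_set_def)
  have ip: "Matrix.vec n z \<bullet> (X *\<^sub>v \<gamma> - X *\<^sub>v \<beta>) = (\<Sum>i<n. z i * img (\<lambda>j. \<gamma> $ j - \<beta> $ j) i)"
    if "\<gamma> \<in> carrier_vec p" for z \<gamma>
  proof -
    have "dim_vec (X *\<^sub>v \<gamma> - X *\<^sub>v \<beta>) = n" using X by simp
    then show ?thesis
      unfolding scalar_prod_def atLeast0LessThan
      by (intro sum.cong) (simp_all add: index[OF that] del: index_minus_vec)
  qed
  have images: "(\<lambda>\<nu>. Matrix.vec n z \<bullet> (\<nu> - X *\<^sub>v \<beta>)) ` ?K t = (\<lambda>k. \<Sum>i<n. z i * k i) ` slice t" for z t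
  proof (intro equalityI subsetI)
    fix y assume "y \<in> (\<lambda>\<nu>. Matrix.vec n z \<bullet> (\<nu> - X *\<^sub>v \<beta>)) ` ?K t"
    then obtain \<gamma> where \<gamma>: "\<gamma> \<in> carrier_vec p" "l1_norm \<gamma> \<le> L"
      and t: "l2_norm (X *\<^sub>v \<gamma> - X *\<^sub>v \<beta>) \<le> t" and y: "y = Matrix.vec n z \<bullet> (X *\<^sub>v \<gamma> - X *\<^sub>v \<beta>)"
      using X by (auto simp: l1_image_def)
    have "(\<lambda>j. \<gamma> $ j - \<beta> $ j) \<in> shifts" using \<gamma> by (simp add: shifts_def l1_norm_def)
    then have "img (\<lambda>j. \<gamma> $ j - \<beta> $ j) \<in> D" unfolding D_def by (rule imageI)
    then have "img (\<lambda>j. \<gamma> $ j - \<beta> $ j) \<in> slice t" using t l2[OF \<gamma>(1)] by (simp add: slice_def)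
    then show "y \<in> (\<lambda>k. \<Sum>i<n. z i * k i) ` slice t"
      unfolding y ip[OF \<gamma>(1)] by (rule imageI)
  next
    fix y assume "y \<in> (\<lambda>k. \<Sum>i<n. z i * k i) ` slice t"
    then obtain k where k: "k \<in> D" "L2_set k {..<n} \<le> t" "y = (\<Sum>i<n. z i * k i)"
      by (auto simp: slice_def)
    then obtain h where h: "h \<in> shifts" "k = img h" unfolding D_def by blast
    define \<gamma> where "\<gamma> = Matrix.vec p (\<lambda>j. \<beta> $ j + h j)"
    have \<gamma>: "\<gamma> \<in> carrier_vec p" by (simp add: \<gamma>_def)
    have img: "img (\<lambda>j. \<gamma> $ j - \<beta> $ j) = k" by (simp add: h img_def fun_eq_iff \<gamma>_def)
    have "l1_norm \<gamma> \<le> L" using h by (simp add: l1_norm_def \<gamma>_def shifts_def)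
    then have "X *\<^sub>v \<gamma> \<in> ?K t" using \<gamma> X k(2) l2[OF \<gamma>] img by (auto simp: l1_image_def)
    moreover have "y = Matrix.vec n z \<bullet> (X *\<^sub>v \<gamma> - X *\<^sub>v \<beta>)" by (simp add: ip[OF \<gamma>] img k)
    ultimately show "y \<in> (\<lambda>\<nu>. Matrix.vec n z \<bullet> (\<nu> - X *\<^sub>v \<beta>)) ` ?K t" by blast
  qed
  have "?K t = {} \<longleftrightarrow> slice t = {}" for t
    using arg_cong[OF images[of undefined t], of "\<lambda>A. A = {}"] by (simp only: image_is_empty)
  then have "localized_width n (l1_image X L) (X *\<^sub>v \<beta>) t = profile t" for t
    by (simp add: localized_width_def profile_def width_def gsup_def images)
  then show ?thesis by (simp add: t_opt_def argmax_def)
qed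

lemma t_opt_lower_interior:
  "0 < \<delta> \<Longrightarrow> 0 < \<epsilon> \<Longrightarrow> \<epsilon> \<le> 1/8 \<Longrightarrow> c1 = sqrt (1 - 4 * \<epsilon>) \<Longrightarrow> c2 = sqrt (1 - 3 * \<epsilon>) \<Longrightarrow>
  c2 * sqrt (ln (real n)) + 1 / 2 + ln (sqrt (2 * pi)) \<le> \<epsilon> / 4 * ln (real n) \<Longrightarrow>
  2 * b * \<delta>\<^sup>2 / r \<le> real n powr (\<epsilon> / 4) \<Longrightarrow>
  real n powr (-1/8) * (2 * sqrt (ln (real n))) \<le> c2 * sqrt (ln (real n)) \<Longrightarrow>
  real n powr (-1/8) * (2 * sqrt (ln (real n))) * (c2 * sqrt (ln (real n))) \<le> 1 \<Longrightarrow>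
  real n powr (-1/8) < 1 \<Longrightarrow>
  c1 * sqrt (ln (real n)) * (\<delta> + 2 * sqrt (real s) * (real n powr (-1/4) / sqrt a))
        + 2 * sqrt (r / a) / (c1 * sqrt (ln (real n)))
      < \<delta> * (c2 * sqrt (ln (real n))) * (1 - 4 * (b / r * real n powr (-1/4) + real n powr (-1)
        + 2 * exp 1 * sqrt (ln (real n)) * real n powr (-1/16))) - 1 / 2 \<Longrightarrow>
  real n powr (1/4 - \<epsilon>) \<le> t_opt n (l1_image X L) (X *\<^sub>v \<beta>)"
  unfolding t_opt_eq_argmax by (rule argmax_ge_powr[OF setup_p])

lemma t_opt_sq_le:
  assumes "0 \<le> \<delta>"
  shows "(t_opt n (l1_image X L) (X *\<^sub>v \<beta>))\<^sup>2 \<le> 4 * L * sqrt (real n) * sqrt (2 * ln (2 * (r * real n)))"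
  using argmax_sq_le[OF assms]
  unfolding t_opt_eq_argmax maxrate_def setup_p by simp

lemma t_opt_le_boundary:
  assumes "\<delta> = 0"
  shows "t_opt n (l1_image X L) (X *\<^sub>v \<beta>) \<le> 4 * sqrt (s / a) * sqrt (2 * ln (2 * (r * real n)))"
  using argmax_le_of_zero_slack[OF assms]
  unfolding t_opt_eq_argmax maxrate_def setup_p by simp

lemma t_opt_ge_exterior:
  "- \<delta> * sqrt (a * real n) \<le> sqrt s * t_opt n (l1_image X L) (X *\<^sub>v \<beta>)"
proof -
  have "sqrt s * t0 \<le> sqrt s * argmax" using argmax_ge by (intro mult_left_mono) auto
  then show ?thesis using t0_ge_of_negative_slack unfolding t_opt_eq_argmax by linarith
qed

lemma t_opt_le_diameter: "t_opt n (l1_image X L) (X *\<^sub>v \<beta>) \<le> sqrt (b * real n) * (2 * L - \<delta>)"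
  using argmax_le_diameter unfolding t_opt_eq_argmax .

end

text \<open>The lower bound weakens as \<open>\<epsilon>\<close> grows, so it is enough to prove it for \<open>min \<epsilon> (1/8)\<close>, which keeps
  the coefficients of \<open>ln n\<close> under the square roots in the thresholds positive.\<close>

lemma t_opt_interior:
  fixes a b r L \<delta> \<epsilon> :: real and s :: nat
  assumes \<delta>: "0 < \<delta>" and \<epsilon>: "0 < \<epsilon>"
  shows "\<exists>C1::real. \<forall>n p X \<beta>.
           lasso_setup n p X \<beta> L a b s \<delta> r \<longrightarrow> real n > C1 \<longrightarrow>
           real n powr (1/4 - \<epsilon>) \<le> t_opt n (l1_image X L) (X *\<^sub>v \<beta>) \<and>
           t_opt n (l1_image X L) (X *\<^sub>v \<beta>) \<le> real n powr (1/4 + \<epsilon>)"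
proof (cases "0 < a \<and> 0 < b \<and> 0 < r \<and> 0 < L")
  case False
  have "\<not> lasso_setup n p X \<beta> L a b s \<delta> r" for n p X \<beta>
  proof
    assume "lasso_setup n p X \<beta> L a b s \<delta> r"
    from setup_ranges[OF this] show False using False by simp
  qed
  then show ?thesis by simp
next
  case True
  define e where "e = min \<epsilon> (1/8)"
  have e: "0 < e" "e \<le> 1/8" "e \<le> \<epsilon>" using \<epsilon> by (auto simp: e_def)
  define c1 where "c1 = sqrt (1 - 4 * e)"
  define c2 where "c2 = sqrt (1 - 3 * e)"
  have c: "0 < c1" "c1 < c2" using e by (auto simp: c1_def c2_def)
  have pos: "0 < a" "0 < b" "0 < r" "0 < L" using True by auto
  note ia = interior_asymptotics[OF pos(1,2,3) \<delta> e(1) of_nat_0_le_iff[of s] c]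
  note up = upper_asymptotics[OF pos(4,3) \<epsilon>]
  obtain C where C: "\<And>N. C \<le> N \<Longrightarrow>
      c2 * sqrt (ln N) + 1 / 2 + ln (sqrt (2 * pi)) \<le> e / 4 * ln N \<and>
      2 * b * \<delta>\<^sup>2 / r \<le> N powr (e / 4) \<and>
      N powr (-1/8) * (2 * sqrt (ln N)) \<le> c2 * sqrt (ln N) \<and>
      N powr (-1/8) * (2 * sqrt (ln N)) * (c2 * sqrt (ln N)) \<le> 1 \<and>
      N powr (-1/8) < 1 \<and>
      c1 * sqrt (ln N) * (\<delta> + 2 * sqrt (real s) * (N powr (-1/4) / sqrt a))
        + 2 * sqrt (r / a) / (c1 * sqrt (ln N))
      < \<delta> * (c2 * sqrt (ln N)) * (1 - 4 * (b / r * N powr (-1/4) + N powr (-1)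
        + 2 * exp 1 * sqrt (ln N) * N powr (-1/16))) - 1 / 2 \<and>
      4 * L * sqrt N * sqrt (2 * ln (2 * (r * N))) \<le> N powr (1/2 + 2 * \<epsilon>)"
    using eventually_conj[OF ia(1) eventually_conj[OF ia(2) eventually_conj[OF ia(3)
      eventually_conj[OF ia(4) eventually_conj[OF ia(5) eventually_conj[OF ia(6) up]]]]]]
    unfolding eventually_at_top_linorder by blast
  show ?thesis
  proof (intro exI[of _ C] allI impI)
    fix n p X \<beta>
    assume lasso: "lasso_setup n p X \<beta> L a b s \<delta> r" and n: "real n > C"
    note Cn = C[OF less_imp_le[OF n]]
    let ?t = "t_opt n (l1_image X L) (X *\<^sub>v \<beta>)"
    have n1: "1 \<le> real n" using setup_ranges(5)[OF lasso] by simp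
    have "real n powr (1/4 - \<epsilon>) \<le> real n powr (1/4 - e)"
      using n1 e by (intro powr_mono) auto
    also have "\<dots> \<le> ?t"
      using Cn by (intro t_opt_lower_interior[OF lasso \<delta> e(1,2) c1_def c2_def]) auto
    finally have lower: "real n powr (1/4 - \<epsilon>) \<le> ?t" .
    have "?t\<^sup>2 \<le> real n powr (1/2 + 2 * \<epsilon>)"
      using t_opt_sq_le[OF lasso] \<delta> Cn by linarith
    also have "\<dots> = (real n powr (1/4 + \<epsilon>))\<^sup>2"
      by (simp add: power2_eq_square powr_add[symmetric])
    finally have "?t \<le> real n powr (1/4 + \<epsilon>)"
      by (rule power2_le_imp_le) simp
    with lower show "real n powr (1/4 - \<epsilon>) \<le> ?t \<and> ?t \<le> real n powr (1/4 + \<epsilon>)" by simp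
  qed
qed

lemma t_opt_boundary:
  fixes a b r L :: real and s :: nat
  shows "\<exists>C2::real. \<forall>n p X \<beta>.
           lasso_setup n p X \<beta> L a b s 0 r \<longrightarrow>
           t_opt n (l1_image X L) (X *\<^sub>v \<beta>) \<le> C2 * sqrt (ln (real n))"
proof (intro exI allI impI)
  fix n p X \<beta>
  assume lasso: "lasso_setup n p X \<beta> L a b s 0 r"
  define c where "c = 1 + \<bar>ln (2 * r)\<bar> / ln 2"
  have n: "2 \<le> real n" and r: "0 < r" and a: "0 < a" using setup_ranges[OF lasso] by auto
  have "ln 2 \<le> ln (real n)" using n by simp
  then have "\<bar>ln (2 * r)\<bar> / ln 2 * ln 2 \<le> \<bar>ln (2 * r)\<bar> / ln 2 * ln (real n)"
    by (intro mult_left_mono) auto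
  then have "ln (2 * (r * real n)) \<le> c * ln (real n)"
    using n r by (simp add: c_def ln_mult distrib_right mult.assoc[symmetric])
  then have "sqrt (2 * ln (2 * (r * real n))) \<le> sqrt (2 * c) * sqrt (ln (real n))"
    by (simp add: real_sqrt_mult[symmetric])
  then have "4 * sqrt (s / a) * sqrt (2 * ln (2 * (r * real n)))
      \<le> 4 * sqrt (s / a) * (sqrt (2 * c) * sqrt (ln (real n)))"
    using a by (intro mult_left_mono) auto
  then show "t_opt n (l1_image X L) (X *\<^sub>v \<beta>)
      \<le> (4 * sqrt (s / a) * sqrt (2 * (1 + \<bar>ln (2 * r)\<bar> / ln 2))) * sqrt (ln (real n))"
    using t_opt_le_boundary[OF lasso] by (simp add: c_def mult.assoc)
qed

lemma t_opt_exterior: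
  fixes a b r L \<delta> :: real and s :: nat
  assumes \<delta>: "\<delta> < 0"
  shows "\<exists>C3>0. \<exists>C4>0. \<forall>n p X \<beta>.
           lasso_setup n p X \<beta> L a b s \<delta> r \<longrightarrow>
           C3 * sqrt (real n) \<le> t_opt n (l1_image X L) (X *\<^sub>v \<beta>) \<and>
           t_opt n (l1_image X L) (X *\<^sub>v \<beta>) \<le> C4 * sqrt (real n)"
proof (cases "0 < a \<and> 0 < b \<and> 0 < L \<and> 0 < s")
  case False
  have "\<not> lasso_setup n p X \<beta> L a b s \<delta> r" for n p X \<beta>
  proof
    assume lasso: "lasso_setup n p X \<beta> L a b s \<delta> r"
    have "s \<noteq> 0"
    proof
      assume "s = 0"
      then have "- \<delta> * sqrt (a * real n) \<le> 0" using t_opt_ge_exterior[OF lasso] by simp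
      moreover have "0 < - \<delta> * sqrt (a * real n)"
        using \<delta> setup_ranges[OF lasso] by (intro mult_pos_pos) auto
      ultimately show False by simp
    qed
    then show False using False setup_ranges[OF lasso] by auto
  qed
  then show ?thesis by (simp add: gt_ex)
next
  case True
  show ?thesis
  proof (rule exI[of _ "- \<delta> * sqrt a / sqrt s"], rule conjI, goal_cases)
    case 1
    show ?case using True \<delta> by (intro divide_pos_pos mult_pos_pos) auto
  next
    case 2
    show ?case
    proof (rule exI[of _ "sqrt b * (2 * L - \<delta>)"], intro conjI allI impI)
      show "0 < sqrt b * (2 * L - \<delta>)" using True \<delta> by (intro mult_pos_pos) auto
      fix n p X \<beta>
      assume lasso: "lasso_setup n p X \<beta> L a b s \<delta> r"
      show "- \<delta> * sqrt a / sqrt s * sqrt (real n) \<le> t_opt n (l1_image X L) (X *\<^sub>v \<beta>)"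
      proof -
        have "- \<delta> * sqrt (a * real n) / sqrt s \<le> t_opt n (l1_image X L) (X *\<^sub>v \<beta>)"
          using t_opt_ge_exterior[OF lasso] True by (subst pos_divide_le_eq) (simp_all add: mult.commute)
        then show ?thesis by (simp add: real_sqrt_mult)
      qed
      show "t_opt n (l1_image X L) (X *\<^sub>v \<beta>) \<le> sqrt b * (2 * L - \<delta>) * sqrt (real n)"
        using t_opt_le_diameter[OF lasso] by (simp add: real_sqrt_mult mult_ac)
    qed
  qed
qed

theorem theorem2p1:
  fixes a b r L \<delta> :: real and s :: nat
  shows "(\<delta> > 0 \<longrightarrow>
            (\<forall>\<epsilon>>0. \<exists>C1::real. \<forall>n p X \<beta>.
               lasso_setup n p X \<beta> L a b s \<delta> r \<longrightarrow> real n > C1 \<longrightarrow>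
               real n powr (1/4 - \<epsilon>) \<le> t_opt n (l1_image X L) (X *\<^sub>v \<beta>) \<and>
               t_opt n (l1_image X L) (X *\<^sub>v \<beta>) \<le> real n powr (1/4 + \<epsilon>)))
       \<and> (\<delta> = 0 \<longrightarrow>
            (\<exists>C2::real. \<forall>n p X \<beta>.
               lasso_setup n p X \<beta> L a b s \<delta> r \<longrightarrow>
               t_opt n (l1_image X L) (X *\<^sub>v \<beta>) \<le> C2 * sqrt (ln (real n))))
       \<and> (\<delta> < 0 \<longrightarrow>
            (\<exists>C3>0. \<exists>C4>0. \<forall>n p X \<beta>.
               lasso_setup n p X \<beta> L a b s \<delta> r \<longrightarrow>
               C3 * sqrt (real n) \<le> t_opt n (l1_image X L) (X *\<^sub>v \<beta>) \<and>
               t_opt n (l1_image X L) (X *\<^sub>v \<beta>) \<le> C4 * sqrt (real n)))"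
proof (intro conjI impI allI)
  show "\<exists>C1::real. \<forall>n p X \<beta>.
         lasso_setup n p X \<beta> L a b s \<delta> r \<longrightarrow> real n > C1 \<longrightarrow>
         real n powr (1/4 - \<epsilon>) \<le> t_opt n (l1_image X L) (X *\<^sub>v \<beta>) \<and>
         t_opt n (l1_image X L) (X *\<^sub>v \<beta>) \<le> real n powr (1/4 + \<epsilon>)" if "\<delta> > 0" "\<epsilon> > 0" for \<epsilon>
    using that by (rule t_opt_interior)
  show "\<exists>C2::real. \<forall>n p X \<beta>.
         lasso_setup n p X \<beta> L a b s \<delta> r \<longrightarrow>
         t_opt n (l1_image X L) (X *\<^sub>v \<beta>) \<le> C2 * sqrt (ln (real n))" if "\<delta> = 0"
    unfolding that by (rule t_opt_boundary)
  show "\<exists>C3>0. \<exists>C4>0. \<forall>n p X \<beta>.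
         lasso_setup n p X \<beta> L a b s \<delta> r \<longrightarrow>
         C3 * sqrt (real n) \<le> t_opt n (l1_image X L) (X *\<^sub>v \<beta>) \<and>
         t_opt n (l1_image X L) (X *\<^sub>v \<beta>) \<le> C4 * sqrt (real n)" if "\<delta> < 0"
    using that by (rule t_opt_exterior)
qed

end
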